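(* Let $\Phi=\{\phi_a\}_{a\in\mathcal{A}}$ be an IFS on $\mathbb{R}^d$ and let $\Psi:\bigcup_{n=1}^\infty\mathcal{A}^n\to[0,\infty)$. Then: \begin{enumerate} \item For any $s\ge 0$, if $\sum_{n=1}^\infty\sum_{\mathbf{a}\in\mathcal{A}^n} n\cdot\Psi(\mathbf{a})^s<\infty$, then $\mathcal{H}^s(W_\Phi(\Psi))=0$. \item Assume that $h_{\mathbf{p}}<-2\log\sum_{a\in\mathcal{A}}p_a^2$ and that $\Psi(\mathbf{a})=\mathrm{Diam}(X_{\mathbf{a}})\,g(|\mathbf{a}|)$ for some non-increasing $g:\mathbb{N}\to[0,\infty)$. If $\sum_{n=1}^\infty\sum_{\mathbf{a}\in\mathcal{A}^n} n\cdot(\mathrm{Diam}(X_{\mathbf{a}})g(n))^{\dim_S(\Phi)}=\infty$, then $\mu(W_\Phi(\Psi))=1$. \item Assume that $\Phi$ is equicontractive and that $\Psi(\mathbf{a})=\mathrm{Diam}(X_{\mathbf{a}})\,g(|\mathbf{a}|)$ for some $g:\mathbb{N}\to[0,\infty)$. If $\sum_{n=1}^\infty\sum_{\mathbf{a}\in\mathcal{A}^n} n\cdot(\mathrm{Diam}(X_{\mathbf{a}})g(n))^{\dim_S(\Phi)}=\infty$, then $\mu(W_\Phi(\Psi))=1$. \end{enumerate}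
   Context: A similarity is a map $\phi:\mathbb{R}^d\to\mathbb{R}^d$ with $\|\phi(x)-\phi(y)\|=r\|x-y\|$ for some $r\in(0,1)$ (its contraction ratio). An IFS is a finite family $\Phi=\{\phi_a\}_{a\in\mathcal{A}}$ of similarities with ratios $r_a$; it is equicontractive if all $r_a$ are equal. Its self-similar set $X$ is the unique non-empty compact set with $X=\bigcup_a\phi_a(X)$. The projection $\pi:\mathcal{A}^{\mathbb{N}}\to X$ is $\pi((a_n))=\lim_{n\to\infty}(\phi_{a_1}\circ\cdots\circ\phi_{a_n})(0)$. For a finite word $\mathbf{a}=a_1\cdots a_n$, $|\mathbf{a}|=n$, $\phi_{\mathbf{a}}=\phi_{a_1}\circ\cdots\circ\phi_{a_n}$, $X_{\mathbf{a}}=\phi_{\mathbf{a}}(X)$; concatenation is written by juxtaposition and $\mathbf{b}^\infty$ is the infinite periodic sequence $\mathbf{b}\mathbf{b}\mathbf{b}\cdots$. The similarity dimension $\dim_S(\Phi)$ is the unique $s$ with $\sum_a r_a^s=1$. Let $\mathbf{p}=(p_a)_{a\in\mathcal{A}}$ with $p_a=r_a^{\dim_S(\Phi)}$, let $\mathfrak{m}$ be the Bernoulli measure on $\mathcal{A}^{\mathbb{N}}$ with marginal $\mathbf{p}$, and $\mu=\pi_*\mathfrak{m}$ (the self-similar measure for $\mathbf{p}$). The entropy is $h_{\mathbf{p}}=-\sum_a p_a\log p_a$. For $\Psi:\bigcup_{n\ge1}\mathcal{A}^n\to[0,\infty)$, $$W_\Phi(\Psi)=\bigcap_{N=1}^\infty\bigcup_{n=N}^\infty\bigcup_{\mathbf{a}\in\mathcal{A}^n}\bigcup_{l=0}^{n-1}B\big(\pi(a_1\cdots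 a_l(a_{l+1}\cdots a_n)^\infty),\Psi(\mathbf{a})\big),$$ where $B(x,r)$ is the open Euclidean ball. $\mathcal{H}^s$ is $s$-dimensional Hausdorff measure. *)

theory Defs
  imports "HOL-Probability.Probability" "HOL-Library.Omega_Words_Fun"
begin

definition similarity_ratio :: "real \<Rightarrow> ('v::metric_space \<Rightarrow> 'v) \<Rightarrow> bool" where
  "similarity_ratio r f \<longleftrightarrow> 0 < r \<and> r < 1 \<and> (\<forall>x y. dist (f x) (f y) = r * dist x y)"

definition similarity :: "('v::metric_space \<Rightarrow> 'v) \<Rightarrow> bool" where
  "similarity f \<longleftrightarrow> (\<exists>r. similarity_ratio r f)"

definition ratio :: "('v::metric_space \<Rightarrow> 'v) \<Rightarrow> real" where
  "ratio f = (THE r. similarity_ratio r f)"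

text \<open>The alphabet is a finite type, so a family indexed by it is finite and non-empty.\<close>

definition IFS :: "('a::finite \<Rightarrow> 'v::euclidean_space \<Rightarrow> 'v) \<Rightarrow> bool" where
  "IFS \<Phi> \<longleftrightarrow> (\<forall>a. similarity (\<Phi> a))"

definition equicontractive :: "('a::finite \<Rightarrow> 'v::euclidean_space \<Rightarrow> 'v) \<Rightarrow> bool" where
  "equicontractive \<Phi> \<longleftrightarrow> (\<forall>a b. ratio (\<Phi> a) = ratio (\<Phi> b))"

definition self_similar_set :: "('a::finite \<Rightarrow> 'v::euclidean_space \<Rightarrow> 'v) \<Rightarrow> 'v set" where
  "self_similar_set \<Phi> = (THE X. compact X \<and> X \<noteq> {} \<and> X = (\<Union>a. \<Phi> a ` X))"

text \<open>\<open>foldr \<Phi> [a\<^sub>1, \<dots>, a\<^sub>n]\<close> is the composition \<open>\<Phi> a\<^sub>1 \<circ> \<dots> \<circ> \<Phi> a\<^sub>n\<close>.\<close>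

abbreviation word_map :: "('a \<Rightarrow> 'v \<Rightarrow> 'v) \<Rightarrow> 'a list \<Rightarrow> 'v \<Rightarrow> 'v" where
  "word_map \<Phi> w \<equiv> foldr \<Phi> w"

definition cylinder_set :: "('a::finite \<Rightarrow> 'v::euclidean_space \<Rightarrow> 'v) \<Rightarrow> 'a list \<Rightarrow> 'v set" where
  "cylinder_set \<Phi> w = word_map \<Phi> w ` self_similar_set \<Phi>"

text \<open>Infinite sequences are functions on \<^typ>\<open>nat\<close>, so the letter \<open>a\<^sub>n\<close> is \<open>x (n - 1)\<close>.\<close>

definition coding :: "('a::finite \<Rightarrow> 'v::euclidean_space \<Rightarrow> 'v) \<Rightarrow> (nat \<Rightarrow> 'a) \<Rightarrow> 'v" where
  "coding \<Phi> x = lim (\<lambda>n. word_map \<Phi> (map x [0..<n]) 0)"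

definition similarity_dim :: "('a::finite \<Rightarrow> 'v::euclidean_space \<Rightarrow> 'v) \<Rightarrow> real" where
  "similarity_dim \<Phi> = (THE s. (\<Sum>a\<in>UNIV. ratio (\<Phi> a) powr s) = 1)"

definition weight :: "('a::finite \<Rightarrow> 'v::euclidean_space \<Rightarrow> 'v) \<Rightarrow> 'a \<Rightarrow> real" where
  "weight \<Phi> a = ratio (\<Phi> a) powr similarity_dim \<Phi>"

definition bernoulli_measure :: "('a::finite \<Rightarrow> real) \<Rightarrow> (nat \<Rightarrow> 'a) measure" where
  "bernoulli_measure p = (\<Pi>\<^sub>M i\<in>UNIV. point_measure UNIV (\<lambda>a. ennreal (p a)))"

definition self_similar_measure :: "('a::finite \<Rightarrow> 'v::euclidean_space \<Rightarrow> 'v) \<Rightarrow> 'v measure" where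
  "self_similar_measure \<Phi> = distr (bernoulli_measure (weight \<Phi>)) borel (coding \<Phi>)"

definition entropy_of :: "('a::finite \<Rightarrow> real) \<Rightarrow> real" where
  "entropy_of p = - (\<Sum>a\<in>UNIV. p a * ln (p a))"

definition W_set :: "('a::finite \<Rightarrow> 'v::euclidean_space \<Rightarrow> 'v) \<Rightarrow> ('a list \<Rightarrow> real) \<Rightarrow> 'v set" where
  "W_set \<Phi> \<Psi> = (\<Inter>N\<in>{1..}. \<Union>n\<in>{N..}. \<Union>w\<in>{w. length w = n}. \<Union>l\<in>{0..n - 1}.
     ball (coding \<Phi> (take l w \<frown> (drop l w)\<^sup>\<omega>)) (\<Psi> w))"

text \<open>
  The case distinctions in the gauge give \<open>diam(U)\<^sup>0 = 1\<close> for every non-empty \<open>U\<close>, including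
  singletons, so that the zero-dimensional measure is counting measure; \<open>powr\<close> alone has
  \<open>0 powr 0 = 0\<close>. Covers must consist of bounded sets because \<^const>\<open>diameter\<close> carries no
  information for unbounded ones.
\<close>

definition hausdorff_gauge :: "real \<Rightarrow> 'v::metric_space set \<Rightarrow> ennreal" where
  "hausdorff_gauge s U =
     (if U = {} then 0 else if s = 0 then 1 else ennreal (diameter U powr s))"

definition hausdorff_premeasure :: "real \<Rightarrow> real \<Rightarrow> 'v::metric_space set \<Rightarrow> ennreal" where
  "hausdorff_premeasure s \<delta> E =
     (INF U \<in> {U :: nat \<Rightarrow> 'v set. E \<subseteq> (\<Union>i. U i) \<and> (\<forall>i. bounded (U i) \<and> diameter (U i) \<le> \<delta>)}.
        \<Sum>i. hausdorff_gauge s (U i))"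

definition hausdorff_measure :: "real \<Rightarrow> 'v::metric_space set \<Rightarrow> ennreal" where
  "hausdorff_measure s E = (SUP \<delta>\<in>{0<..}. hausdorff_premeasure s \<delta> E)"

text \<open>
  The series \<open>\<Sum>\<^bsub>n\<ge>1\<^esub> \<Sum>\<^bsub>w\<in>A\<^sup>n\<^esub> n F(w)\<^sup>s\<close> as an extended non-negative real; the index is
  shifted by one to start at words of length 1. Here \<open>0\<^sup>0 = 0\<close>, the convention of \<open>powr\<close>.
\<close>

definition word_series :: "real \<Rightarrow> ('a::finite list \<Rightarrow> real) \<Rightarrow> ennreal" where
  "word_series s F = (\<Sum>n. \<Sum>w\<in>{w. length w = Suc n}. ennreal (real (Suc n) * F w powr s))"

end

(*
  Part 1 is the covering argument with the balls themselves. For Parts 2 and 3 put s = dim_S and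
  c(n) = min(1, g(n)^s), so that the divergence hypothesis reads: sum of n c(n) is infinite. For
  each starting position l of the period, cut the word read from l as soon as its weight drops
  below c(n); its ratio is then below g(n). If this word reappears at position n, the sequence
  agrees with the eventually periodic one long enough for its coding to lie in the ball of the
  word of length n.

  Such a recurrence has probability comparable to c(n), and for two of them with different lags
  n - l the joint probability is at most c(n) c(n'), whatever the weights: a forced letter costs
  exactly its own weight, so the product of the inverse weights of the forced letters is a
  martingale, and where the two copies overlap the agreement of their sources has to be paid for
  as well. Recurrences with equal lags are exponentially decorrelated in n' - n. The second-moment
  method then bounds the probability of the limsup event below; as l tends to infinity with n,
  that event is a tail event, and Kolmogorov's 0-1 law makes it almost sure.
*)
theory Submission
  imports Defs
begin

section \<open>Bernoulli measures on sequences\<close>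

text \<open>Cutting by weight instead of at a fixed length is what handles unequal ratios: since p_a
  = r_a^s, the cut word has weight between \<open>pmin\<close> * c(n) and c(n) whatever its letters,
  so all recurrences have comparable probability. The price is a random cut length: the copied
  letters do not occupy a fixed set of coordinates, and independence cannot be applied to them
  directly. Predictable prescriptions of letters take the place of conditioning. The starting
  positions are confined to n/4 <= l <= n/2 and the cut length to n/4, so that source letters
  charged for an overlap lie to the left of both copies and are not counted twice. The lengths n
  with c(n) <= pmax^(n div 4) are dropped for this; they carry only a convergent part of the series.
  Of order n positions remain for each n, which preserves the factor n of the hypothesis.\<close>

definition determined_on :: "'i set \<Rightarrow> (('i \<Rightarrow> 'a) \<Rightarrow> 'b) \<Rightarrow> bool" where
  "determined_on I f \<longleftrightarrow> (\<forall>x y. (\<forall>i\<in>I. x i = y i) \<longrightarrow> f x = f y)"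

lemma determined_onD: "determined_on I f \<Longrightarrow> (\<And>i. i \<in> I \<Longrightarrow> x i = y i) \<Longrightarrow> f x = f y"
  by (auto simp: determined_on_def)

lemma determined_onI:
  "(\<And>x y. (\<And>i. i \<in> I \<Longrightarrow> x i = y i) \<Longrightarrow> f x = f y) \<Longrightarrow> determined_on I f"
  unfolding determined_on_def by blast

lemma determined_on_compose2:
  "determined_on I f \<Longrightarrow> determined_on I g \<Longrightarrow> determined_on I (\<lambda>x. h (f x) (g x))"
  unfolding determined_on_def by metis

locale bernoulli_scheme =
  fixes p :: "'a::finite \<Rightarrow> real"
  assumes p_pos: "0 < p a" and p_less_1: "p a < 1" and p_sum: "(\<Sum>a\<in>UNIV. p a) = 1"
begin

abbreviation M :: "(nat \<Rightarrow> 'a) measure" where "M \<equiv> bernoulli_measure p"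

lemma emeasure_letter: "emeasure (point_measure UNIV (\<lambda>a. ennreal (p a))) X = ennreal (sum p X)"
  by (subst emeasure_point_measure_finite) (auto simp: sum_ennreal p_pos less_imp_le)

lemma prob_space_letter: "prob_space (point_measure UNIV (\<lambda>a. ennreal (p a)))"
  by (rule prob_spaceI) (simp add: emeasure_letter space_point_measure p_sum)

lemma product_letters: "product_prob_space (\<lambda>_::nat. point_measure UNIV (\<lambda>a. ennreal (p a)))"
  using prob_space_letter by (intro product_prob_spaceI)

lemma space_M [simp]: "space M = UNIV"
  by (auto simp: bernoulli_measure_def space_PiM space_point_measure)

lemma prob_space_M: "prob_space M"
  unfolding bernoulli_measure_def by (intro prob_space_PiM prob_space_letter)

sublocale prob_space M by (rule prob_space_M)

lemma sets_coordinate: "{x. x i \<in> S} \<in> sets M"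
proof -
  have "(\<lambda>x. x i) -` S \<inter> space M \<in> sets M"
    unfolding bernoulli_measure_def
    by (intro measurable_sets[OF measurable_component_singleton]) (auto simp: sets_point_measure)
  then show ?thesis by (simp add: vimage_def)
qed

lemma prob_box:
  assumes "finite J"
  shows "prob {x. \<forall>i\<in>J. x i \<in> X i} = (\<Prod>i\<in>J. sum p (X i))"
proof -
  interpret P: product_prob_space "\<lambda>_::nat. point_measure UNIV (\<lambda>a. ennreal (p a))" UNIV
    by (rule product_letters)
  have "emeasure M {x. \<forall>i\<in>J. x i \<in> X i} = (\<Prod>i\<in>J. ennreal (sum p (X i)))"
    using P.emeasure_PiM_Collect[of J X] assms space_M
    by (simp add: emeasure_letter bernoulli_measure_def sets_point_measure)
  also have "\<dots> = ennreal (\<Prod>i\<in>J. sum p (X i))"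
    by (intro prod_ennreal) (auto intro!: sum_nonneg less_imp_le[OF p_pos])
  finally show ?thesis
    by (simp add: measure_def prod_nonneg sum_nonneg less_imp_le p_pos)
qed

definition coordinate_sets :: "nat \<Rightarrow> (nat \<Rightarrow> 'a) set set" where
  "coordinate_sets i = range (\<lambda>S. {x. x i \<in> S})"

text \<open>Finite \<open>I\<close> and a finite alphabet make the set a finite union of cylinders.
  The separate index set \<open>J\<close> lets one statement serve both for measurability
  (\<open>J\<close> = \<open>I\<close>) and for membership in a tail sigma-algebra.\<close>

lemma determined_on_sigma_sets:
  assumes "finite I" "determined_on I P" "I \<subseteq> J"
  shows "{x. P x} \<in> sigma_sets UNIV (\<Union>(coordinate_sets ` J))"
proof -
  let ?S = "sigma_sets UNIV (\<Union>(coordinate_sets ` J))"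
  interpret S: sigma_algebra UNIV ?S
    by (rule sigma_algebra_sigma_sets) auto
  have box: "{x. x i = f i} \<in> ?S" if "i \<in> I" for i f
    using that assms(3) by (intro sigma_sets.Basic) (auto simp: coordinate_sets_def intro!: image_eqI[of _ _ "{f i}"])
  have boxes: "{x. \<forall>i\<in>I. x i = f i} \<in> ?S" for f
  proof -
    have "(\<Inter>i\<in>I. {x. x i = f i}) \<in> ?S" if "I \<noteq> {}"
      using that assms(1) box by (intro S.finite_INT) auto
    moreover have "(\<Inter>i\<in>I. {x. x i = f i}) = {x. \<forall>i\<in>I. x i = f i}" by auto
    ultimately show ?thesis by (cases "I = {}") (auto intro: S.top)
  qed
  have "{x. P x} = (\<Union>f\<in>{f \<in> I \<rightarrow>\<^sub>E UNIV. P f}. {x. \<forall>i\<in>I. x i = f i})"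
  proof (intro equalityI subsetI)
    fix x assume "x \<in> {x. P x}"
    moreover have "P (restrict x I) = P x"
      by (rule determined_onD[OF assms(2)]) auto
    ultimately show "x \<in> (\<Union>f\<in>{f \<in> I \<rightarrow>\<^sub>E UNIV. P f}. {x. \<forall>i\<in>I. x i = f i})"
      by (intro UN_I[of "restrict x I"]) auto
  next
    fix x assume "x \<in> (\<Union>f\<in>{f \<in> I \<rightarrow>\<^sub>E UNIV. P f}. {x. \<forall>i\<in>I. x i = f i})"
    then obtain f where "P f" "\<And>i. i \<in> I \<Longrightarrow> x i = f i" by auto
    then show "x \<in> {x. P x}" using determined_onD[OF assms(2), of f x] by auto
  qed
  also have "\<dots> \<in> ?S"
    using assms(1) boxes by (intro S.finite_UN) (auto intro: finite_subset[OF _ finite_PiE])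
  finally show ?thesis .
qed

lemma coordinate_sets_events: "coordinate_sets i \<subseteq> events"
  using sets_coordinate by (auto simp: coordinate_sets_def)

lemma determined_on_sets:
  assumes "finite I" "determined_on I P"
  shows "{x. P x} \<in> sets M"
proof -
  have "sigma_sets (space M) (\<Union>(coordinate_sets ` I)) \<subseteq> sets M"
    using coordinate_sets_events by (intro sets.sigma_sets_subset) auto
  then show ?thesis using determined_on_sigma_sets[OF assms subset_refl] by auto
qed

lemma determined_on_measurable:
  assumes "finite I" "determined_on I f"
  shows "f \<in> borel_measurable M"
proof (rule measurableI)
  fix A
  have "determined_on I (\<lambda>x. f x \<in> A)"
    using assms(2) unfolding determined_on_def by metis
  from determined_on_sets[OF assms(1) this]
  show "f -` A \<inter> space M \<in> sets M" by (simp add: vimage_def)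
qed auto

lemma determined_on_bounded:
  fixes f :: "(nat \<Rightarrow> 'a) \<Rightarrow> real"
  assumes "finite I" "determined_on I f"
  shows "\<exists>B. \<forall>x. \<bar>f x\<bar> \<le> B"
proof -
  let ?F = "(\<lambda>w. \<bar>f w\<bar>) ` (I \<rightarrow>\<^sub>E UNIV)"
  have "finite ?F" using assms(1) by (intro finite_imageI finite_PiE) auto
  moreover have "\<bar>f x\<bar> \<in> ?F" for x
  proof (rule image_eqI[of _ _ "restrict x I"])
    show "\<bar>f x\<bar> = \<bar>f (restrict x I)\<bar>"
      by (rule arg_cong[where f = abs], rule determined_onD[OF assms(2)]) auto
  qed auto
  ultimately show ?thesis by (meson Max_ge)
qed

lemma determined_on_integrable:
  fixes f :: "(nat \<Rightarrow> 'a) \<Rightarrow> real"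
  assumes "finite I" "determined_on I f"
  shows "integrable M f"
proof -
  obtain B where "\<And>x. \<bar>f x\<bar> \<le> B" using determined_on_bounded[OF assms] by blast
  then show ?thesis
    by (intro integrable_const_bound[of _ B] determined_on_measurable[OF assms]) auto
qed

lemma sum_over_words:
  fixes f :: "('i \<Rightarrow> 'a) \<Rightarrow> real"
  assumes "finite I" "determined_on I f"
  shows "f x = (\<Sum>w\<in>I \<rightarrow>\<^sub>E UNIV. f w * indicator {x. \<forall>i\<in>I. x i = w i} x)"
proof -
  have "(\<Sum>w\<in>I \<rightarrow>\<^sub>E UNIV. f w * indicator {x. \<forall>i\<in>I. x i = w i} x)
      = (\<Sum>w\<in>I \<rightarrow>\<^sub>E UNIV. if w = restrict x I then f w else 0)"
    by (intro sum.cong) (auto simp: indicator_def fun_eq_iff PiE_def extensional_def)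
  also have "\<dots> = f (restrict x I)"
    using assms(1) by (subst sum.delta) (auto intro!: finite_PiE)
  also have "\<dots> = f x" by (rule determined_onD[OF assms(2)]) auto
  finally show ?thesis by simp
qed

lemma expectation_over_words:
  assumes "finite I" "determined_on I f"
  shows "expectation f = (\<Sum>w\<in>I \<rightarrow>\<^sub>E UNIV. f w * (\<Prod>i\<in>I. p (w i)))"
proof -
  have m: "prob {x. \<forall>i\<in>I. x i = w i} = (\<Prod>i\<in>I. p (w i))" for w
    using prob_box[OF assms(1), of "\<lambda>i. {w i}"] by simp
  have s: "{x. \<forall>i\<in>I. x i = w i} \<in> sets M" for w
    by (rule determined_on_sets[OF assms(1)]) (auto simp: determined_on_def)
  have "expectation f
      = expectation (\<lambda>x. \<Sum>w\<in>I \<rightarrow>\<^sub>E UNIV. f w * indicator {x. \<forall>i\<in>I. x i = w i} x)"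
    by (subst sum_over_words[OF assms, symmetric]) simp
  also have "\<dots> = (\<Sum>w\<in>I \<rightarrow>\<^sub>E UNIV. f w * prob {x. \<forall>i\<in>I. x i = w i})"
    using s by (subst Bochner_Integration.integral_sum) (auto simp: emeasure_eq_measure)
  finally show ?thesis by (simp add: m)
qed

text \<open>Given the first \<open>m\<close> letters, the letter at \<open>m\<close> hits the
  prescribed \<open>b x\<close> with probability \<open>p (b x)\<close>, so the reweighting factor
  has conditional mean 1. Summing over the words of length \<open>m\<close> avoids conditional
  expectations.\<close>

lemma expectation_reweighted_letter:
  assumes f: "determined_on {..<m} f" and b: "determined_on {..<m} b"
  shows "expectation (\<lambda>x. f x * (if x m = b x then 1 / p (b x) else 0)) = expectation f"
proof -
  let ?W = "{..<m} \<rightarrow>\<^sub>E (UNIV :: 'a set)"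
  let ?C = "\<lambda>w. {x. \<forall>i\<in>{..<Suc m}. x i = (w(m := b w)) i}"
  have m: "prob (?C w) = p (b w) * (\<Prod>i<m. p (w i))" for w
    using prob_box[of "{..<Suc m}" "\<lambda>i. {(w(m := b w)) i}"] by simp
  have s: "?C w \<in> sets M" for w
    by (rule determined_on_sets[of "{..<Suc m}"]) (auto simp: determined_on_def)
  let ?g = "\<lambda>x. \<Sum>w\<in>?W. f w / p (b w) * indicator (?C w) x"
  have "f x * (if x m = b x then 1 / p (b x) else 0) = ?g x" for x
  proof -
    let ?h = "\<lambda>w. f w * (if x m = b w then 1 / p (b w) else 0)"
    have "f x * (if x m = b x then 1 / p (b x) else 0) = ?h (restrict x {..<m})"
      using determined_onD[OF f, of x "restrict x {..<m}"]
        determined_onD[OF b, of x "restrict x {..<m}"] by simp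
    also have "\<dots> = (\<Sum>w\<in>?W. if w = restrict x {..<m} then ?h w else 0)"
      by (subst sum.delta) (auto intro: finite_PiE)
    also have "\<dots> = ?g x"
    proof (intro sum.cong refl)
      fix w assume w: "w \<in> ?W"
      have 1: "w = restrict x {..<m} \<longleftrightarrow> (\<forall>i<m. x i = w i)"
        using w by (auto simp: fun_eq_iff PiE_def extensional_def)
      have 2: "x \<in> ?C w \<longleftrightarrow> (\<forall>i<m. x i = w i) \<and> x m = b w"
        by (auto simp: less_Suc_eq)
      show "(if w = restrict x {..<m} then ?h w else 0)
          = f w / p (b w) * indicator (?C w) x"
        unfolding indicator_def 2 1 by simp
    qed
    finally show ?thesis .
  qed
  then have "expectation (\<lambda>x. f x * (if x m = b x then 1 / p (b x) else 0)) = expectation ?g"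
    by presburger
  also have "\<dots> = (\<Sum>w\<in>?W. f w / p (b w) * prob (?C w))"
    using s by (subst Bochner_Integration.integral_sum) (auto simp: emeasure_eq_measure)
  also have "\<dots> = (\<Sum>w\<in>?W. f w * (\<Prod>i<m. p (w i)))"
    using p_pos by (intro sum.cong refl) (simp only: m, simp add: less_imp_neq[symmetric])
  finally show ?thesis
    using expectation_over_words[OF finite_lessThan f] by simp
qed

end

section \<open>Forced letters\<close>

context bernoulli_scheme
begin

text \<open>
  \<open>b t x = Some a\<close> prescribes the letter \<open>a\<close> at time \<open>t\<close>, given the earlier letters. The weights
  form a martingale in \<open>N\<close> when the prescriptions are predictable.
\<close>

definition forcing_weight ::
    "(nat \<Rightarrow> (nat \<Rightarrow> 'a) \<Rightarrow> 'a option) \<Rightarrow> nat \<Rightarrow> (nat \<Rightarrow> 'a) \<Rightarrow> real" where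
  "forcing_weight b N x =
     (\<Prod>t<N. case b t x of None \<Rightarrow> 1 | Some a \<Rightarrow> if x t = a then 1 / p a else 0)"

lemma determined_on_forcing_weight:
  assumes "\<And>t. t < N \<Longrightarrow> determined_on {..<t} (b t)"
  shows "determined_on {..<N} (forcing_weight b N)"
proof (rule determined_onI)
  fix x y :: "nat \<Rightarrow> 'a" assume eq: "\<And>i. i \<in> {..<N} \<Longrightarrow> x i = y i"
  have "b t x = b t y" if "t < N" for t
    by (rule determined_onD[OF assms[OF that]]) (use eq that in auto)
  with eq show "forcing_weight b N x = forcing_weight b N y"
    unfolding forcing_weight_def by (intro prod.cong) (auto split: option.splits)
qed

lemma expectation_forcing_weight:
  assumes "\<And>t. t < N \<Longrightarrow> determined_on {..<t} (b t)"
  shows "expectation (forcing_weight b N) = 1"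
  using assms
proof (induction N)
  case 0
  show ?case by (simp add: forcing_weight_def prob_space[simplified])
next
  case (Suc N)
  let ?Z = "forcing_weight b N"
  let ?some = "\<lambda>x. if b N x = None then 0 else ?Z x"
  let ?none = "\<lambda>x. if b N x = None then ?Z x else 0"
  let ?step = "\<lambda>x. ?some x * (if x N = the (b N x) then 1 / p (the (b N x)) else 0)"
  have Z: "determined_on {..<N} ?Z" using Suc.prems by (intro determined_on_forcing_weight) auto
  have b: "determined_on {..<N} (b N)" using Suc.prems by auto
  have some: "determined_on {..<N} ?some" and none: "determined_on {..<N} ?none"
    and the: "determined_on {..<N} (\<lambda>x. the (b N x))"
    using determined_on_compose2[OF b Z, of "\<lambda>v z. if v = None then 0 else z"]
      determined_on_compose2[OF b Z, of "\<lambda>v z. if v = None then z else 0"]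
      determined_on_compose2[OF b Z, of "\<lambda>v _. the v"] by simp_all
  have step: "determined_on {..<Suc N} ?step"
  proof (rule determined_onI)
    fix x y :: "nat \<Rightarrow> 'a" assume eq: "\<And>i. i \<in> {..<Suc N} \<Longrightarrow> x i = y i"
    have "?some x = ?some y" by (rule determined_onD[OF some]) (use eq in auto)
    moreover have "the (b N x) = the (b N y)" by (rule determined_onD[OF the]) (use eq in auto)
    moreover have "x N = y N" by (rule eq) simp
    ultimately show "?step x = ?step y" by presburger
  qed
  note int = determined_on_integrable[OF finite_lessThan]
  have eq: "forcing_weight b (Suc N) = (\<lambda>x. ?none x + ?step x)"
    by (auto simp: forcing_weight_def fun_eq_iff split: option.splits)
  have "expectation (forcing_weight b (Suc N)) = expectation ?none + expectation ?step"
    unfolding eq by (rule Bochner_Integration.integral_add[OF int[OF none] int[OF step]])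
  also have "expectation ?step = expectation ?some"
    by (rule expectation_reweighted_letter[OF some the])
  also have "expectation ?none + expectation ?some = expectation (\<lambda>x. ?none x + ?some x)"
    by (rule Bochner_Integration.integral_add[OF int[OF none] int[OF some], symmetric])
  also have "(\<lambda>x. ?none x + ?some x) = ?Z" by auto
  finally show ?case using Suc by simp
qed

lemma forcing_weight_nonneg: "0 \<le> forcing_weight b N x"
  unfolding forcing_weight_def
  by (intro prod_nonneg) (auto split: option.splits intro: less_imp_le[OF p_pos])

lemma forcing_weight_eq:
  assumes "\<And>t. t < N \<Longrightarrow> b t x = (if t \<in> A then Some (x t) else None)" "A \<subseteq> {..<N}"
  shows "forcing_weight b N x = 1 / (\<Prod>t\<in>A. p (x t))"
proof -
  have "forcing_weight b N x = (\<Prod>t<N. if t \<in> A then 1 / p (x t) else 1)"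
    unfolding forcing_weight_def using assms by (intro prod.cong) auto
  also have "\<dots> = (\<Prod>t\<in>A. 1 / p (x t))"
    using assms(2) by (subst prod.inter_restrict[symmetric]) (auto simp: Int_absorb1)
  finally show ?thesis by (simp add: prod_dividef)
qed

text \<open>A change of measure: on \<open>S\<close> the forcing weight is at least 1 / C, so C
  times a variable of mean 1 dominates the indicator. The set \<open>A\<close> of forced times may
  depend on \<open>x\<close>, as a random cut length requires.\<close>

lemma prob_le_if_forced:
  assumes b: "\<And>t. t < N \<Longrightarrow> determined_on {..<t} (b t)"
    and S: "S \<in> sets M"
    and forced: "\<And>x. x \<in> S \<Longrightarrow> \<exists>A. A \<subseteq> {..<N} \<and>
      (\<forall>t<N. b t x = (if t \<in> A then Some (x t) else None)) \<and> (\<Prod>t\<in>A. p (x t)) \<le> C"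
    and C: "0 \<le> C"
  shows "prob S \<le> C"
proof -
  have "integrable M (forcing_weight b N)"
    by (rule determined_on_integrable[OF finite_lessThan determined_on_forcing_weight[OF b]])
  moreover have "indicator S x \<le> C * forcing_weight b N x" for x
  proof (cases "x \<in> S")
    case True
    then obtain A where A: "A \<subseteq> {..<N}" "(\<Prod>t\<in>A. p (x t)) \<le> C"
      "\<And>t. t < N \<Longrightarrow> b t x = (if t \<in> A then Some (x t) else None)"
      using forced by blast
    have "0 < (\<Prod>t\<in>A. p (x t))" by (intro prod_pos) (simp add: p_pos)
    with A(2) show ?thesis
      by (simp add: forcing_weight_eq[of N b x A, OF A(3) A(1)] True)
  qed (simp add: C forcing_weight_nonneg)
  ultimately have "expectation (indicator S) \<le> expectation (\<lambda>x. C * forcing_weight b N x)"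
    using S by (intro integral_mono) (auto simp: emeasure_eq_measure)
  also have "\<dots> = C" by (simp add: expectation_forcing_weight[OF b])
  finally show ?thesis using S by simp
qed

text \<open>The reverse comparison: a violated prescription makes the forcing weight vanish off
  \<open>S\<close>, so C times the weight stays below the indicator.\<close>

lemma prob_ge_if_forced:
  assumes b: "\<And>t. t < N \<Longrightarrow> determined_on {..<t} (b t)"
    and S: "S \<in> sets M"
    and forced: "\<And>x. x \<in> S \<Longrightarrow> \<exists>A. A \<subseteq> {..<N} \<and>
      (\<forall>t<N. b t x = (if t \<in> A then Some (x t) else None)) \<and> C \<le> (\<Prod>t\<in>A. p (x t))"
    and not_forced: "\<And>x. x \<notin> S \<Longrightarrow> \<exists>t<N. \<exists>a. b t x = Some a \<and> x t \<noteq> a"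
  shows "C \<le> prob S"
proof -
  have "integrable M (forcing_weight b N)"
    by (rule determined_on_integrable[OF finite_lessThan determined_on_forcing_weight[OF b]])
  moreover have "C * forcing_weight b N x \<le> indicator S x" for x
  proof (cases "x \<in> S")
    case True
    then obtain A where A: "A \<subseteq> {..<N}" "C \<le> (\<Prod>t\<in>A. p (x t))"
      "\<And>t. t < N \<Longrightarrow> b t x = (if t \<in> A then Some (x t) else None)"
      using forced by blast
    have "0 < (\<Prod>t\<in>A. p (x t))" by (intro prod_pos) (simp add: p_pos)
    with A(2) show ?thesis
      by (simp add: forcing_weight_eq[of N b x A, OF A(3) A(1)] True)
  next
    case False
    then obtain t a where "t < N" "b t x = Some a" "x t \<noteq> a" using not_forced by blast
    then have "forcing_weight b N x = 0"
      unfolding forcing_weight_def by (intro prod_zero bexI[of _ t]) auto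
    then show ?thesis by simp
  qed
  ultimately have "expectation (\<lambda>x. C * forcing_weight b N x) \<le> expectation (indicator S)"
    using S by (intro integral_mono) (auto simp: emeasure_eq_measure)
  then have "C * expectation (forcing_weight b N) \<le> prob S" using S by simp
  then show ?thesis using expectation_forcing_weight[of N b, OF b] by simp
qed

section \<open>Words cut by weight and their reappearance\<close>

text \<open>
  The word read from position \<open>l\<close> is cut as soon as its weight drops below \<open>c\<close>; the event
  \<open>recurrence c K n l\<close> says that this cut word reappears at position \<open>n\<close>.
\<close>

definition uncut :: "real \<Rightarrow> nat \<Rightarrow> nat \<Rightarrow> (nat \<Rightarrow> 'a) \<Rightarrow> bool" where
  "uncut c l j x \<longleftrightarrow> c \<le> (\<Prod>i<j. p (x (l + i)))"

definition recurrence :: "real \<Rightarrow> nat \<Rightarrow> nat \<Rightarrow> nat \<Rightarrow> (nat \<Rightarrow> 'a) set" where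
  "recurrence c K n l = {x. \<forall>j<K. uncut c l j x \<longrightarrow> x (n + j) = x (l + j)}"

definition pmax :: real where "pmax = Max (range p)"
definition pmin :: real where "pmin = Min (range p)"

lemma p_le_pmax: "p a \<le> pmax" and pmin_le_p: "pmin \<le> p a"
  by (auto simp: pmax_def pmin_def)

lemma pmax_less_1: "pmax < 1" and pmin_pos: "0 < pmin"
  using p_less_1 p_pos by (auto simp: pmax_def pmin_def)

lemma pmax_pos: "0 < pmax"
  using p_pos p_le_pmax less_le_trans by blast

lemma word_weight_pos: "0 < (\<Prod>i<j. p (x (l + i)))"
  by (intro prod_pos) (simp add: p_pos)

lemma word_weight_antimono:
  fixes x :: "nat \<Rightarrow> 'a"
  shows "k \<le> m \<Longrightarrow> (\<Prod>i<m. p (x (l + i))) \<le> (\<Prod>i<k. p (x (l + i)))"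
proof (induction m rule: dec_induct)
  case (step n)
  have "(\<Prod>i<n. p (x (l + i))) * p (x (l + n)) \<le> (\<Prod>i<n. p (x (l + i))) * 1"
    using word_weight_pos p_less_1 by (intro mult_left_mono) (auto intro: less_imp_le)
  with step show ?case by simp
qed simp

lemma word_weight_le: "(\<Prod>i<j. p (x (l + i))) \<le> pmax ^ j"
  using prod_mono[of "{..<j}" "\<lambda>i. p (x (l + i))" "\<lambda>_. pmax"] p_le_pmax p_pos
  by (simp add: less_imp_le)

lemma uncut_cong: "(\<And>i. i < j \<Longrightarrow> x (l + i) = y (l + i)) \<Longrightarrow> uncut c l j x = uncut c l j y"
  unfolding uncut_def by (metis (mono_tags, lifting) lessThan_iff prod.cong)

text \<open>Each letter multiplies the weight by at most \<open>pmax\<close>, so pmax^K < c puts the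
  cut within the first \<open>K\<close> letters, and the cap \<open>K\<close> in
  \<open>recurrence\<close> does not shorten the copied word. The letter that causes the drop
  contributes a factor of at least \<open>pmin\<close>, whence the lower bound.\<close>

lemma cut_length_exists:
  assumes "pmax ^ K < c"
  obtains k where "k \<le> K" "\<And>j. uncut c l j x \<longleftrightarrow> j < k" "(\<Prod>i<k. p (x (l + i))) < c"
    "c \<le> 1 \<Longrightarrow> pmin * c \<le> (\<Prod>i<k. p (x (l + i)))"
proof -
  define k where "k = (LEAST k. \<not> uncut c l k x)"
  have K: "\<not> uncut c l K x"
    using assms word_weight_le[of x l K] by (simp add: uncut_def)
  have k: "\<not> uncut c l k x" unfolding k_def by (rule LeastI[of _ K]) (rule K)
  have less: "uncut c l j x" if "j < k" for j
    using that not_less_Least unfolding k_def by blast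
  show thesis
  proof (rule that)
    show "k \<le> K" unfolding k_def by (rule Least_le) (rule K)
    show "uncut c l j x \<longleftrightarrow> j < k" for j
      using k less word_weight_antimono[of k j x l] unfolding uncut_def by force
    show "(\<Prod>i<k. p (x (l + i))) < c" using k by (simp add: uncut_def)
    have "0 < c" using assms zero_less_power[OF pmax_pos, of K] by linarith
    assume "c \<le> 1"
    \<comment> \<open>The empty word has weight 1, so \<open>c \<le> 1\<close> guarantees a last
      letter to strip off; the word before it is still uncut.\<close>
    then obtain j where j: "k = Suc j" using k by (cases k) (auto simp: uncut_def)
    have "pmin * c \<le> p (x (l + j)) * (\<Prod>i<j. p (x (l + i)))"
      using less[of j] j pmin_le_p[of "x (l + j)"] pmin_pos p_pos[of "x (l + j)"]
        word_weight_pos[of x l j] \<open>0 < c\<close>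
      by (intro mult_mono) (auto simp: uncut_def)
    then show "pmin * c \<le> (\<Prod>i<k. p (x (l + i)))" by (simp add: j mult.commute)
  qed
qed

text \<open>The range starts at \<open>l\<close>, not at 0: events with large \<open>l\<close>
  ignore the early letters, which is what the tail property needs.\<close>

lemma determined_on_recurrence:
  assumes "l \<le> n"
  shows "determined_on {l..<n + K} (\<lambda>x. x \<in> recurrence c K n l)"
proof (rule determined_onI)
  fix x y :: "nat \<Rightarrow> 'a" assume eq: "\<And>i. i \<in> {l..<n + K} \<Longrightarrow> x i = y i"
  have "uncut c l j x = uncut c l j y" "x (n + j) = y (n + j)" "x (l + j) = y (l + j)"
    if "j < K" for j
    using assms that by (auto intro!: eq uncut_cong)
  then show "(x \<in> recurrence c K n l) = (y \<in> recurrence c K n l)"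
    unfolding recurrence_def mem_Collect_eq by metis
qed

lemma sets_recurrence: "l \<le> n \<Longrightarrow> recurrence c K n l \<in> sets M"
  using determined_on_sets[OF _ determined_on_recurrence] by auto

end

section \<open>Probabilities of recurrences\<close>

context bernoulli_scheme
begin

lemma prod_window:
  fixes x :: "nat \<Rightarrow> 'a"
  assumes "\<And>j. j < k \<Longrightarrow> x (n + j) = y j"
  shows "(\<Prod>t\<in>{n..<n + k}. p (x t)) = (\<Prod>j<k. p (y j))"
  using assms by (induction k) (auto simp: mult.commute)

lemma uncut_below_cong:
  "l + j \<le> t \<Longrightarrow> (\<And>i. i \<in> {..<t} \<Longrightarrow> x i = y i) \<Longrightarrow> uncut c l j x = uncut c l j y"
  by (rule uncut_cong) auto

lemma recurrenceD:
  assumes "x \<in> recurrence c K n l" "k \<le> K" "\<And>j. uncut c l j x \<longleftrightarrow> j < k" "j < k"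
  shows "x (n + j) = x (l + j)"
  using assms by (auto simp: recurrence_def)

text \<open>At each time t >= n the source letter is prescribed as long as the source word read so
  far is uncut. Since l < n, both this test and the source letter lie before t, even when source and
  copy overlap. On the event the prescribed letters are exactly the cut word, of weight at least
  \<open>pmin * c\<close>.\<close>

lemma prob_recurrence_ge:
  assumes K: "pmax ^ K < c" and "c \<le> 1" "l < n"
  shows "pmin * c \<le> prob (recurrence c K n l)"
proof (rule prob_ge_if_forced)
  let ?b = "\<lambda>t x. if n \<le> t \<and> uncut c l (t - n) x then Some (x (l + (t - n))) else None"
  show "determined_on {..<t} (?b t)" for t
  proof (rule determined_onI)
    fix x y :: "nat \<Rightarrow> 'a" assume eq: "\<And>i. i \<in> {..<t} \<Longrightarrow> x i = y i"
    have "uncut c l (t - n) x = uncut c l (t - n) y" "x (l + (t - n)) = y (l + (t - n))"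
      if "n \<le> t"
      using that \<open>l < n\<close> by (auto intro!: eq uncut_below_cong[of _ _ t])
    then show "?b t x = ?b t y" by auto
  qed
  show "recurrence c K n l \<in> sets M" using \<open>l < n\<close> by (intro sets_recurrence) simp
  show "\<exists>A. A \<subseteq> {..<n + K} \<and> (\<forall>t<n + K. ?b t x = (if t \<in> A then Some (x t) else None)) \<and>
      pmin * c \<le> (\<Prod>t\<in>A. p (x t))" if x: "x \<in> recurrence c K n l" for x
  proof -
    obtain k where k: "k \<le> K" "\<And>j. uncut c l j x \<longleftrightarrow> j < k" "pmin * c \<le> (\<Prod>i<k. p (x (l + i)))"
      using cut_length_exists[OF K] \<open>c \<le> 1\<close> by metis
    note r = recurrenceD[OF x k(1,2)]
    have "x (l + (t - n)) = x t" if "n \<le> t" "t - n < k" for t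
      using r[OF that(2)] that by simp
    moreover have "pmin * c \<le> (\<Prod>t\<in>{n..<n + k}. p (x t))"
      using k(3) prod_window[of k x n, OF r] by simp
    ultimately show ?thesis
      using k(1,2) by (intro exI[of _ "{n..<n + k}"]) auto
  qed
  show "\<exists>t<n + K. \<exists>a. ?b t x = Some a \<and> x t \<noteq> a" if out: "x \<notin> recurrence c K n l" for x
  proof -
    obtain j where "j < K" "uncut c l j x" "x (n + j) \<noteq> x (l + j)"
      using out by (auto simp: recurrence_def)
    then show ?thesis by (intro exI[of _ "n + j"]) auto
  qed
qed

text \<open>
  On the intersection both copies are forced. Where they overlap, the two source windows must
  agree, and this agreement is charged to the rightmost source window.
\<close>

lemma prob_recurrence_inter_le:
  assumes K1: "pmax ^ K1 < c1" and K2: "pmax ^ K2 < c2"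
    and n: "n1 \<le> n2" and l: "l1 < n1" "l2 < n2" and ne: "l1 + (n2 - n1) \<noteq> l2"
    and room: "l1 + K1 \<le> n1" "l2 + K1 \<le> n2"
  shows "prob (recurrence c1 K1 n1 l1 \<inter> recurrence c2 K2 n2 l2) \<le> c1 * c2"
proof -
  \<comment> \<open>The second copy starts \<open>q\<close> places after the first, so on an overlap
    the letter at n2 + j equals both x (l1 + q + j) and x (l2 + j). The later of these two sources
    starts at \<open>m\<close>, the earlier at \<open>m'\<close>. They differ because the lags do,
    so the letter at m + j is predicted by the one at m' + j.\<close>
  define q where "q = n2 - n1"
  define m where "m = max (l1 + q) l2"
  define m' where "m' = min (l1 + q) l2"
  have m: "m' < m" "l1 + q \<le> m" "l2 \<le> m" using ne by (auto simp: m_def m'_def q_def)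
  have c: "0 < c1" "0 < c2"
    using K1 K2 zero_less_power[OF pmax_pos] by (meson less_trans)+
  define N where "N = n2 + K1 + K2"
  \<comment> \<open>On an overlap the first branch wins and the second copy costs nothing there; the
    third branch collects this missing cost. Its two \<open>uncut\<close> tests say that the overlap
    reaches offset t - m, and they read only letters before \<open>t\<close>.\<close>
  define b where "b t x =
    (if n1 \<le> t \<and> uncut c1 l1 (t - n1) x then Some (x (l1 + (t - n1)))
     else if n2 \<le> t \<and> uncut c2 l2 (t - n2) x then Some (x (l2 + (t - n2)))
     else if m \<le> t \<and> uncut c1 l1 (q + (t - m)) x \<and> uncut c2 l2 (t - m) x
       then Some (x (m' + (t - m))) else None)" for t and x :: "nat \<Rightarrow> 'a"
  have det: "determined_on {..<t} (b t)" for t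
  proof (rule determined_onI)
    fix x y :: "nat \<Rightarrow> 'a" assume eq: "\<And>i. i \<in> {..<t} \<Longrightarrow> x i = y i"
    have "uncut c1 l1 (t - n1) x = uncut c1 l1 (t - n1) y" "x (l1 + (t - n1)) = y (l1 + (t - n1))"
      if "n1 \<le> t"
      using that l by (auto intro!: eq uncut_below_cong[of _ _ t])
    moreover have "uncut c2 l2 (t - n2) x = uncut c2 l2 (t - n2) y"
      "x (l2 + (t - n2)) = y (l2 + (t - n2))" if "n2 \<le> t"
      using that l by (auto intro!: eq uncut_below_cong[of _ _ t])
    moreover have "uncut c1 l1 (q + (t - m)) x = uncut c1 l1 (q + (t - m)) y"
      "uncut c2 l2 (t - m) x = uncut c2 l2 (t - m) y" "x (m' + (t - m)) = y (m' + (t - m))"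
      if "m \<le> t"
      using that m by (auto intro!: eq uncut_below_cong[of _ _ t])
    ultimately show "b t x = b t y" unfolding b_def by auto
  qed
  show ?thesis
  proof (rule prob_le_if_forced[of N b])
    show "determined_on {..<t} (b t)" for t by (rule det)
    show "recurrence c1 K1 n1 l1 \<inter> recurrence c2 K2 n2 l2 \<in> sets M"
      using l by (intro sets.Int sets_recurrence) auto
    fix x assume x: "x \<in> recurrence c1 K1 n1 l1 \<inter> recurrence c2 K2 n2 l2"
    obtain k1 where k1: "k1 \<le> K1" "\<And>j. uncut c1 l1 j x \<longleftrightarrow> j < k1"
      "(\<Prod>i<k1. p (x (l1 + i))) < c1" using cut_length_exists[OF K1] by metis
    obtain k2 where k2: "k2 \<le> K2" "\<And>j. uncut c2 l2 j x \<longleftrightarrow> j < k2"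
      "(\<Prod>i<k2. p (x (l2 + i))) < c2" using cut_length_exists[OF K2] by metis
    have r1: "x (n1 + j) = x (l1 + j)" if "j < k1" for j
      using x k1 that by (intro recurrenceD[of _ c1 K1 n1 l1 k1]) auto
    have r2: "x (n2 + j) = x (l2 + j)" if "j < k2" for j
      using x k2 that by (intro recurrenceD[of _ c2 K2 n2 l2 k2]) auto
    \<comment> \<open>Truncated subtraction gives \<open>k = 0\<close> when the first copy ends
      before \<open>n2\<close>, so disjoint copies cause no extra charge.\<close>
    define k where "k = min (k1 - q) k2"
    have s: "x (l1 + q + j) = x (n2 + j)" "x (l2 + j) = x (n2 + j)" if "j < k" for j
      using that r1[of "q + j"] r2[of j] n by (auto simp: k_def q_def add.assoc)
    have s': "x (m + j) = x (n2 + j)" "x (m' + j) = x (m + j)" if "j < k" for j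
      using s[OF that] unfolding m_def m'_def by (auto simp: max_def min_def)
    \<comment> \<open>\<open>room\<close> places the charged letters before \<open>n1\<close>, hence
      outside both copies.\<close>
    have mk: "m + j < n1" if "j < k" for j
      using that room k1(1) n unfolding k_def m_def q_def by (auto simp: max_def)
    let ?I = "{n1..<n1 + k1}" and ?J = "{n2..<n2 + k2}" and ?L = "{m..<m + k}"
    have IJ: "?I \<inter> ?J = {n2..<n2 + k}" using n by (auto simp: k_def q_def)
    have L: "?L \<inter> (?I \<union> ?J) = {}"
    proof -
      have "t < n1" if "t \<in> ?L" for t using mk[of "t - m"] that by auto
      then show ?thesis using n by fastforce
    qed
    \<comment> \<open>The letters in \<open>?L\<close> repeat those on the overlap. Their weight
      supplies the factor that the union of the copies counts only once, and the product becomes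
      that of two complete cut words.\<close>
    have "(\<Prod>t\<in>?L \<union> (?I \<union> ?J). p (x t)) = (\<Prod>t\<in>?L. p (x t)) * (\<Prod>t\<in>?I \<union> ?J. p (x t))"
      using L by (intro prod.union_disjoint) auto
    also have "(\<Prod>t\<in>?L. p (x t)) = (\<Prod>t\<in>?I \<inter> ?J. p (x t))"
      unfolding IJ using prod_window[of k x m "\<lambda>j. x (n2 + j)"] s'(1)
        prod_window[of k x n2 "\<lambda>j. x (n2 + j)"] by simp
    also have "\<dots> * (\<Prod>t\<in>?I \<union> ?J. p (x t)) = (\<Prod>t\<in>?I. p (x t)) * (\<Prod>t\<in>?J. p (x t))"
      using prod.union_inter[of ?I ?J "\<lambda>t. p (x t)"] by (simp add: mult.commute)
    also have "\<dots> = (\<Prod>i<k1. p (x (l1 + i))) * (\<Prod>i<k2. p (x (l2 + i)))"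
      using prod_window[of k1 x n1, OF r1] prod_window[of k2 x n2, OF r2] by simp
    also have "\<dots> \<le> c1 * c2"
      using k1(3) k2(3) c word_weight_pos[of x l2 k2]
      by (intro mult_mono) (auto intro: less_imp_le)
    finally have le: "(\<Prod>t\<in>?L \<union> (?I \<union> ?J). p (x t)) \<le> c1 * c2" .
    have "b t x = (if t \<in> ?L \<union> (?I \<union> ?J) then Some (x t) else None)" for t
    proof -
      have i: "t \<in> ?I \<longleftrightarrow> n1 \<le> t \<and> uncut c1 l1 (t - n1) x" by (auto simp: k1(2))
      have j: "t \<in> ?J \<longleftrightarrow> n2 \<le> t \<and> uncut c2 l2 (t - n2) x" by (auto simp: k2(2))
      have l: "t \<in> ?L \<longleftrightarrow> m \<le> t \<and> uncut c1 l1 (q + (t - m)) x \<and> uncut c2 l2 (t - m) x"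
        by (auto simp: k1(2) k2(2) k_def)
      have bt: "b t x = (if t \<in> ?I then Some (x (l1 + (t - n1)))
          else if t \<in> ?J then Some (x (l2 + (t - n2)))
          else if t \<in> ?L then Some (x (m' + (t - m))) else None)"
        unfolding b_def i j l by (rule refl)
      consider "t \<in> ?I" | "t \<notin> ?I" "t \<in> ?J" | "t \<notin> ?I" "t \<notin> ?J" "t \<in> ?L"
        | "t \<notin> ?I" "t \<notin> ?J" "t \<notin> ?L" by blast
      then show ?thesis
      proof cases
        case 1
        then have "b t x = Some (x (l1 + (t - n1)))" by (simp only: bt if_True if_False)
        then show ?thesis using 1 r1[of "t - n1"] by auto
      next
        case 2
        then have "b t x = Some (x (l2 + (t - n2)))" by (simp only: bt if_True if_False)
        then show ?thesis using 2 r2[of "t - n2"] by auto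
      next
        case 3
        then have "b t x = Some (x (m' + (t - m)))" by (simp only: bt if_True if_False)
        then show ?thesis using 3 s'(2)[of "t - m"] by auto
      next
        case 4
        then have "b t x = None" by (simp only: bt if_True if_False)
        then show ?thesis using 4 by auto
      qed
    qed
    moreover have "?L \<union> (?I \<union> ?J) \<subseteq> {..<N}"
    proof -
      have "t < N" if "t \<in> ?L" for t
      proof -
        have "t - m < k" using that by auto
        with mk[of "t - m"] n that show ?thesis by (auto simp: N_def)
      qed
      moreover have "?I \<subseteq> {..<N}" "?J \<subseteq> {..<N}" using k1(1) k2(1) n by (auto simp: N_def)
      ultimately show ?thesis by blast
    qed
    ultimately show "\<exists>A. A \<subseteq> {..<N} \<and>
        (\<forall>t<N. b t x = (if t \<in> A then Some (x t) else None)) \<and> (\<Prod>t\<in>A. p (x t)) \<le> c1 * c2"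
      using le by blast
  qed (use c in simp)
qed

text \<open>With equal lags the two sources of an overlap coincide and no agreement can be charged.
  Only the first \<open>q\<close> letters of the first copy are used, since they precede the second
  copy. If the first word is cut within them they cost less than \<open>c1\<close>, otherwise at
  most pmax^q.\<close>

lemma prob_recurrence_inter_shift_le:
  assumes K1: "pmax ^ K1 < c1" and K2: "pmax ^ K2 < c2" and "l < n"
  shows "prob (recurrence c1 K1 n l \<inter> recurrence c2 K2 (n + q) (l + q)) \<le> (c1 + pmax ^ q) * c2"
proof -
  have c: "0 < c1" "0 < c2"
    using K1 K2 zero_less_power[OF pmax_pos] by (meson less_trans)+
  define N where "N = n + q + K1 + K2"
  define b where "b t x =
    (if n \<le> t \<and> t < n + q \<and> uncut c1 l (t - n) x then Some (x (l + (t - n)))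
     else if n + q \<le> t \<and> uncut c2 (l + q) (t - (n + q)) x then Some (x (l + (t - n)))
     else None)" for t and x :: "nat \<Rightarrow> 'a"
  have det: "determined_on {..<t} (b t)" for t
  proof (rule determined_onI)
    fix x y :: "nat \<Rightarrow> 'a" assume eq: "\<And>i. i \<in> {..<t} \<Longrightarrow> x i = y i"
    have "uncut c1 l (t - n) x = uncut c1 l (t - n) y" "x (l + (t - n)) = y (l + (t - n))"
      if "n \<le> t"
      using that \<open>l < n\<close> by (auto intro!: eq uncut_below_cong[of _ _ t])
    moreover have "uncut c2 (l + q) (t - (n + q)) x = uncut c2 (l + q) (t - (n + q)) y"
      if "n + q \<le> t"
      using that \<open>l < n\<close> by (auto intro!: eq uncut_below_cong[of _ _ t])
    ultimately show "b t x = b t y" unfolding b_def by auto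
  qed
  show ?thesis
  proof (rule prob_le_if_forced[of N b])
    show "determined_on {..<t} (b t)" for t by (rule det)
    show "recurrence c1 K1 n l \<inter> recurrence c2 K2 (n + q) (l + q) \<in> sets M"
      using \<open>l < n\<close> by (intro sets.Int sets_recurrence) auto
    fix x assume x: "x \<in> recurrence c1 K1 n l \<inter> recurrence c2 K2 (n + q) (l + q)"
    obtain k1 where k1: "k1 \<le> K1" "\<And>j. uncut c1 l j x \<longleftrightarrow> j < k1"
      "(\<Prod>i<k1. p (x (l + i))) < c1" using cut_length_exists[OF K1] by metis
    obtain k2 where k2: "k2 \<le> K2" "\<And>j. uncut c2 (l + q) j x \<longleftrightarrow> j < k2"
      "(\<Prod>i<k2. p (x (l + q + i))) < c2" using cut_length_exists[OF K2] by metis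
    have r1: "x (n + j) = x (l + j)" if "j < k1" for j
      using x k1 that by (intro recurrenceD[of _ c1 K1 n l k1]) auto
    have r2: "x (n + q + j) = x (l + q + j)" if "j < k2" for j
      using x k2 that by (intro recurrenceD[of _ c2 K2 "n + q" "l + q" k2]) auto
    define k where "k = min k1 q"
    let ?I = "{n..<n + k}" and ?J = "{n + q..<n + q + k2}"
    have "(\<Prod>t\<in>?I \<union> ?J. p (x t)) = (\<Prod>t\<in>?I. p (x t)) * (\<Prod>t\<in>?J. p (x t))"
      by (intro prod.union_disjoint) (auto simp: k_def)
    also have "\<dots> = (\<Prod>i<k. p (x (l + i))) * (\<Prod>i<k2. p (x (l + q + i)))"
      using prod_window[of k x n "\<lambda>j. x (l + j)"] r1 prod_window[of k2 x "n + q", OF r2]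
      by (simp add: k_def)
    also have "\<dots> \<le> (c1 + pmax ^ q) * c2"
    proof (intro mult_mono)
      show "(\<Prod>i<k. p (x (l + i))) \<le> c1 + pmax ^ q"
      proof (cases "k1 \<le> q")
        case True
        then show ?thesis using k1(3) pmax_pos by (simp add: k_def add_increasing2)
      next
        case False
        then show ?thesis using word_weight_le[of x l q] c by (simp add: k_def)
      qed
    qed (use k2(3) c pmax_pos word_weight_pos[of x "l + q" k2] in auto)
    finally have le: "(\<Prod>t\<in>?I \<union> ?J. p (x t)) \<le> (c1 + pmax ^ q) * c2" .
    have "b t x = (if t \<in> ?I \<union> ?J then Some (x t) else None)" for t
    proof -
      have i: "t \<in> ?I \<longleftrightarrow> n \<le> t \<and> t < n + q \<and> uncut c1 l (t - n) x"
        by (auto simp: k1(2) k_def)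
      have j: "t \<in> ?J \<longleftrightarrow> n + q \<le> t \<and> uncut c2 (l + q) (t - (n + q)) x"
        by (auto simp: k2(2))
      have bt: "b t x = (if t \<in> ?I then Some (x (l + (t - n)))
          else if t \<in> ?J then Some (x (l + (t - n))) else None)"
        unfolding b_def i j by (rule refl)
      consider "t \<in> ?I" | "t \<notin> ?I" "t \<in> ?J" | "t \<notin> ?I" "t \<notin> ?J" by blast
      then show ?thesis
      proof cases
        case 1
        then have "b t x = Some (x (l + (t - n)))" by (simp only: bt if_True if_False)
        then show ?thesis using 1 r1[of "t - n"] by (auto simp: k_def)
      next
        case 2
        then have "b t x = Some (x (l + (t - n)))" by (simp only: bt if_True if_False)
        moreover have "l + q + (t - (n + q)) = l + (t - n)" using 2 by auto
        ultimately show ?thesis using 2 r2[of "t - (n + q)"] by auto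
      next
        case 3
        then have "b t x = None" by (simp only: bt if_True if_False)
        then show ?thesis using 3 by auto
      qed
    qed
    moreover have "?I \<union> ?J \<subseteq> {..<N}" using k1(1) k2(1) by (auto simp: N_def k_def)
    ultimately show "\<exists>A. A \<subseteq> {..<N} \<and> (\<forall>t<N. b t x = (if t \<in> A then Some (x t) else None)) \<and>
        (\<Prod>t\<in>A. p (x t)) \<le> (c1 + pmax ^ q) * c2"
      using le by blast
  qed (use c pmax_pos in simp)
qed

end

section \<open>Almost sure recurrence\<close>

text \<open>Truncated subtraction turns the exponent into the distance between \<open>m\<close> and
  \<open>n\<close>; either side of \<open>n\<close> is bounded by a full geometric series.\<close>

lemma sum_power_dist_le:
  fixes r :: real
  assumes "0 \<le> r" "r < 1" "finite F"
  shows "(\<Sum>m\<in>F. r ^ ((n - m) + (m - n))) \<le> 2 / (1 - r)"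
proof -
  have geom: "(\<Sum>k\<in>G. r ^ k) \<le> 1 / (1 - r)" if "finite G" for G
    using sum_le_suminf[of "\<lambda>k. r ^ k" G] that assms by (simp add: suminf_geometric)
  have "(\<Sum>m\<in>F. r ^ ((n - m) + (m - n)))
      = (\<Sum>m\<in>F \<inter> {..n}. r ^ ((n - m) + (m - n))) + (\<Sum>m\<in>F - {..n}. r ^ ((n - m) + (m - n)))"
    using assms(3) by (rule sum.Int_Diff)
  also have "(\<Sum>m\<in>F \<inter> {..n}. r ^ ((n - m) + (m - n))) = (\<Sum>k\<in>(\<lambda>m. n - m) ` (F \<inter> {..n}). r ^ k)"
    by (subst sum.reindex) (auto simp: inj_on_def)
  also have "(\<Sum>m\<in>F - {..n}. r ^ ((n - m) + (m - n))) = (\<Sum>k\<in>(\<lambda>m. m - n) ` (F - {..n}). r ^ k)"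
    by (subst sum.reindex) (auto simp: inj_on_def)
  also have "(\<Sum>k\<in>(\<lambda>m. n - m) ` (F \<inter> {..n}). r ^ k) + \<dots> \<le> 1 / (1 - r) + 1 / (1 - r)"
    using assms(3) by (intro add_mono geom) auto
  finally show ?thesis by simp
qed

text \<open>For the number f of events that occur, (1 - s f)^2 >= 0 gives 2 s f - s^2 f^2 <= 1, and
  the left side is 0 where f = 0. Integrating this with the optimal s = e / v takes the place of the
  Cauchy-Schwarz inequality.\<close>

lemma (in prob_space) prob_UN_ge_second_moment:
  assumes D: "finite D" and R: "\<And>d. d \<in> D \<Longrightarrow> R d \<in> events"
    and e: "0 \<le> e" "e \<le> (\<Sum>d\<in>D. prob (R d))"
    and v: "0 < v" "(\<Sum>d\<in>D. \<Sum>d'\<in>D. prob (R d \<inter> R d')) \<le> v"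
  shows "e\<^sup>2 / v \<le> prob (\<Union>d\<in>D. R d)"
proof -
  let ?f = "\<lambda>x. \<Sum>d\<in>D. indicator (R d) x :: real"
  let ?g = "\<lambda>x. \<Sum>d\<in>D. \<Sum>d'\<in>D. indicator (R d \<inter> R d') x :: real"
  have sq: "?g x = (?f x)\<^sup>2" for x
    by (simp add: power2_eq_square sum_product indicator_inter_arith)
  have f: "expectation ?f = (\<Sum>d\<in>D. prob (R d))" "integrable M ?f"
    using R by (auto simp: emeasure_eq_measure)
  have g: "expectation ?g = (\<Sum>d\<in>D. \<Sum>d'\<in>D. prob (R d \<inter> R d'))" "integrable M ?g"
    using R by (auto simp: emeasure_eq_measure)
  have U: "(\<Union>d\<in>D. R d) \<in> events" using D R by auto
  define s where "s = e / v"
  have "0 \<le> s" using e v by (simp add: s_def)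
  have "2 * s * ?f x - s\<^sup>2 * ?g x \<le> indicator (\<Union>d\<in>D. R d) x" for x
  proof (cases "x \<in> (\<Union>d\<in>D. R d)")
    case True
    have "0 \<le> (1 - s * ?f x)\<^sup>2" by simp
    then have "2 * s * ?f x - s\<^sup>2 * (?f x)\<^sup>2 \<le> 1" by (simp add: power2_eq_square algebra_simps)
    with True show ?thesis by (simp add: sq)
  next
    case False
    then have "?f x = 0" by (intro sum.neutral) auto
    with False show ?thesis by (simp add: sq)
  qed
  then have "expectation (\<lambda>x. 2 * s * ?f x - s\<^sup>2 * ?g x) \<le> expectation (indicator (\<Union>d\<in>D. R d))"
    using U f(2) g(2)
    by (intro integral_mono Bochner_Integration.integrable_diff integrable_mult_right)
      (auto simp: emeasure_eq_measure)
  also have "expectation (\<lambda>x. 2 * s * ?f x - s\<^sup>2 * ?g x) = 2 * s * expectation ?f - s\<^sup>2 * expectation ?g"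
    using f(2) g(2) by (subst Bochner_Integration.integral_diff) (auto simp del: Bochner_Integration.integral_sum)
  also have "expectation (indicator (\<Union>d\<in>D. R d)) = prob (\<Union>d\<in>D. R d)" using U by simp
  finally have "2 * s * expectation ?f - s\<^sup>2 * expectation ?g \<le> prob (\<Union>d\<in>D. R d)" .
  moreover have "2 * s * e - s\<^sup>2 * v \<le> 2 * s * expectation ?f - s\<^sup>2 * expectation ?g"
    unfolding f g using e v \<open>0 \<le> s\<close> by (intro diff_mono mult_left_mono) auto
  moreover have "2 * s * e - s\<^sup>2 * v = e\<^sup>2 / v"
    using v by (simp add: s_def field_simps power2_eq_square)
  ultimately show ?thesis by linarith
qed

context bernoulli_scheme
begin

lemma sigma_algebra_coordinate_sets: "sigma_algebra (space M) (coordinate_sets i)"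
proof -
  have "coordinate_sets i = sets (vimage_algebra UNIV (\<lambda>x. x i) (count_space UNIV))"
    by (auto simp: coordinate_sets_def vimage_def sets_vimage_algebra2)
  then show ?thesis
    using sets.sigma_algebra_axioms[of "vimage_algebra UNIV (\<lambda>x. x i) (count_space UNIV)"] by simp
qed

lemma indep_coordinate_sets: "indep_sets coordinate_sets UNIV"
proof (rule indep_setsI)
  fix A and J :: "nat set"
  assume J: "finite J" and A: "\<forall>j\<in>J. A j \<in> coordinate_sets j"
  then obtain S where S: "\<And>j. j \<in> J \<Longrightarrow> A j = {x. x j \<in> S j}"
    unfolding coordinate_sets_def image_iff by metis
  have "(\<Inter>j\<in>J. A j) = {x. \<forall>j\<in>J. x j \<in> S j}" using S by auto
  moreover have "prob (A j) = sum p (S j)" if "j \<in> J" for j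
    using prob_box[of "{j}" S] S[OF that] by simp
  ultimately show "prob (\<Inter>j\<in>J. A j) = (\<Prod>j\<in>J. prob (A j))"
    using prob_box[OF J, of S] by simp
qed (rule coordinate_sets_events)

section \<open>Second moment of the return events\<close>

definition returns :: "(nat \<Rightarrow> real) \<Rightarrow> nat \<times> nat \<Rightarrow> (nat \<Rightarrow> 'a) set" where
  "returns c d = recurrence (c (fst d)) (fst d div 4) (fst d) (snd d)"

text \<open>A pair stands for (n, l). The lower bound on \<open>l\<close> makes the event forget
  early letters as n grows; the upper bound, with the cap \<open>n div 4\<close> on the cut length,
  provides the \<open>room\<close> required by \<open>prob_recurrence_inter_le\<close>.\<close>

definition return_times :: "(nat \<Rightarrow> real) \<Rightarrow> nat \<Rightarrow> (nat \<times> nat) set" where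
  "return_times c N = {(n, l). N \<le> n \<and> pmax ^ (n div 4) < c n \<and> n div 4 \<le> l \<and> l \<le> n div 2}"

lemma return_times_pos:
  assumes "d \<in> return_times c N" "\<And>n. c n \<le> 1"
  shows "0 < fst d" "snd d < fst d" "0 < c (fst d)"
proof -
  \<comment> \<open>At length 0 membership would mean 1 < c 0, contrary to the bound on
    \<open>c\<close>.\<close>
  show n: "0 < fst d"
    using assms(1) assms(2)[of 0] by (cases "fst d") (auto simp: return_times_def)
  then show "snd d < fst d" using assms(1) by (auto simp: return_times_def)
  show "0 < c (fst d)"
    using assms(1) zero_less_power[OF pmax_pos] less_trans by (fastforce simp: return_times_def)
qed

text \<open>The equation in the condition says that the lags n - l and n' - l' coincide, written
  without subtraction. The estimate for equal lags is weakened to a form symmetric in the two pairs,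
  so that they may be ordered by \<open>fst\<close>.\<close>

lemma prob_returns_inter_le:
  assumes d: "d \<in> return_times c N" "d' \<in> return_times c N" and c: "\<And>n. c n \<le> 1"
  shows "prob (returns c d \<inter> returns c d') \<le> c (fst d) * c (fst d') +
    (if fst d + snd d' = fst d' + snd d
     then pmax ^ ((fst d - fst d') + (fst d' - fst d)) * (c (fst d) + c (fst d')) else 0)"
    (is "?P d d' \<le> ?B d d'")
proof -
  have ordered: "?P e e' \<le> ?B e e'"
    if e: "e \<in> return_times c N" "e' \<in> return_times c N" and le: "fst e \<le> fst e'" for e e'
  proof (cases "fst e + snd e' = fst e' + snd e")
    case True
    define q where "q = fst e' - fst e"
    have eq: "fst e' = fst e + q" "snd e' = snd e + q" using le True by (auto simp: q_def)
    have "?P e e' \<le> (c (fst e) + pmax ^ q) * c (fst e')"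
      unfolding returns_def eq using e return_times_pos[OF e(1) c]
      by (intro prob_recurrence_inter_shift_le) (auto simp: return_times_def eq[symmetric])
    also have "\<dots> \<le> c (fst e) * c (fst e') + pmax ^ q * (c (fst e) + c (fst e'))"
      using return_times_pos[OF e(1) c] pmax_pos by (simp add: algebra_simps)
    finally show ?thesis using True eq by simp
  next
    case False
    have "?P e e' \<le> c (fst e) * c (fst e')"
      unfolding returns_def
    proof (rule prob_recurrence_inter_le)
      show "snd e < fst e" "snd e' < fst e'" using return_times_pos[OF _ c] e by auto
      show "pmax ^ (fst e div 4) < c (fst e)" "pmax ^ (fst e' div 4) < c (fst e')"
        using e by (auto simp: return_times_def)
      show "snd e + (fst e' - fst e) \<noteq> snd e'" using False le by auto
      have "snd e \<le> fst e div 2" "snd e' \<le> fst e' div 2" using e by (auto simp: return_times_def)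
      then show "snd e + fst e div 4 \<le> fst e" "snd e' + fst e div 4 \<le> fst e'"
        using le by linarith+
    qed (rule le)
    then show ?thesis using False by simp
  qed
  show ?thesis
  proof (cases "fst d \<le> fst d'")
    case True
    then show ?thesis using ordered d by blast
  next
    case False
    have "?P d d' = ?P d' d" by (simp add: Int_commute)
    also have "\<dots> \<le> ?B d' d" using ordered[OF d(2,1)] False by simp
    also have "\<dots> = ?B d d'" by (auto simp: mult.commute add.commute)
    finally show ?thesis .
  qed
qed

text \<open>The numerator is the square of the factor \<open>pmin\<close> lost in the lower bound
  for a single return; the denominator is 1 + 2 C, where C = 2 / (1 - pmax) bounds the two-sided
  geometric sum over returns of equal lag.\<close>

definition hit_bound :: real where "hit_bound = pmin\<^sup>2 / (1 + 4 / (1 - pmax))"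

lemma hit_bound_pos: "0 < hit_bound"
  using pmin_pos pmax_less_1 by (auto simp: hit_bound_def intro!: divide_pos_pos add_pos_pos)

lemma sets_returns: "d \<in> return_times c N \<Longrightarrow> (\<And>n. c n \<le> 1) \<Longrightarrow> returns c d \<in> sets M"
  using return_times_pos(2) by (auto simp: returns_def intro!: sets_recurrence less_imp_le)

text \<open>The second moment is at most S^2 + 2 C S for the total mass S: the product terms give
  S^2, and for a fixed pair those of the same lag add a geometric sum. S >= 1 absorbs the linear
  term, so the bound depends on neither \<open>D\<close> nor \<open>N\<close>.\<close>

lemma prob_UN_returns_ge:
  assumes D: "finite D" "D \<subseteq> return_times c N" and c: "\<And>n. c n \<le> 1"
    and S: "1 \<le> (\<Sum>d\<in>D. c (fst d))"
  shows "hit_bound \<le> prob (\<Union>d\<in>D. returns c d)"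
proof -
  define S where "S = (\<Sum>d\<in>D. c (fst d))"
  have cpos: "0 < c (fst d)" if "d \<in> D" for d
    using return_times_pos(3)[of d c N] c that D(2) by blast
  define C where "C = 2 / (1 - pmax)"
  define near where "near d d' = (if fst d + snd d' = fst d' + snd d
     then pmax ^ ((fst d - fst d') + (fst d' - fst d)) else 0)" for d d' :: "nat \<times> nat"
  have near: "(\<Sum>d'\<in>D. near d d') \<le> C" for d
  proof -
    let ?D = "{d' \<in> D. fst d + snd d' = fst d' + snd d}"
    have "(\<Sum>d'\<in>D. near d d') = (\<Sum>d'\<in>?D. pmax ^ ((fst d - fst d') + (fst d' - fst d)))"
      unfolding near_def using D(1) by (simp add: sum.inter_filter)
    \<comment> \<open>Among pairs of a fixed lag the first component determines the second.\<close>
    also have "\<dots> = (\<Sum>m\<in>fst ` ?D. pmax ^ ((fst d - m) + (m - fst d)))"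
      by (subst sum.reindex) (auto simp: inj_on_def)
    also have "\<dots> \<le> C"
      unfolding C_def using D(1) pmax_pos pmax_less_1 by (intro sum_power_dist_le) auto
    finally show ?thesis .
  qed
  have sym: "near d d' = near d' d" for d d' by (auto simp: near_def add.commute)
  have "(\<Sum>d\<in>D. \<Sum>d'\<in>D. prob (returns c d \<inter> returns c d'))
      \<le> (\<Sum>d\<in>D. \<Sum>d'\<in>D. c (fst d) * c (fst d') + (near d d' * c (fst d) + near d' d * c (fst d')))"
  proof (intro sum_mono)
    fix d d' assume "d \<in> D" "d' \<in> D"
    then have "d \<in> return_times c N" "d' \<in> return_times c N" using D(2) by auto
    then have "prob (returns c d \<inter> returns c d')
        \<le> c (fst d) * c (fst d') + near d d' * (c (fst d) + c (fst d'))"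
      using prob_returns_inter_le[of d c N d'] c by (auto simp: near_def)
    then show "prob (returns c d \<inter> returns c d')
        \<le> c (fst d) * c (fst d') + (near d d' * c (fst d) + near d' d * c (fst d'))"
      using sym[of d d'] by (simp add: distrib_left)
  qed
  also have "\<dots> = S * S + ((\<Sum>d\<in>D. (\<Sum>d'\<in>D. near d d') * c (fst d))
      + (\<Sum>d'\<in>D. (\<Sum>d\<in>D. near d' d) * c (fst d')))"
  proof -
    have "(\<Sum>d\<in>D. \<Sum>d'\<in>D. near d' d * c (fst d')) = (\<Sum>d'\<in>D. (\<Sum>d\<in>D. near d' d) * c (fst d'))"
      by (subst sum.swap) (simp add: sum_distrib_right)
    moreover have "(\<Sum>d\<in>D. \<Sum>d'\<in>D. c (fst d) * c (fst d')) = S * S"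
      unfolding S_def by (rule sum_product[symmetric])
    ultimately show ?thesis
      by (simp add: sum.distrib sum_distrib_right)
  qed
  also have "\<dots> \<le> S * S + ((\<Sum>d\<in>D. C * c (fst d)) + (\<Sum>d'\<in>D. C * c (fst d')))"
    using near cpos by (intro add_mono sum_mono mult_right_mono order_refl) (auto intro: less_imp_le)
  also have "\<dots> = S * S + 2 * C * S"
    by (simp add: S_def sum_distrib_left mult.assoc)
  also have "\<dots> \<le> S\<^sup>2 * (1 + 2 * C)"
  proof -
    have "0 \<le> C" using pmax_less_1 by (simp add: C_def)
    moreover have "S \<le> S\<^sup>2" using S self_le_power[of S 2] by (simp add: S_def)
    ultimately have "2 * C * S \<le> 2 * C * S\<^sup>2" by (intro mult_left_mono) auto
    then show ?thesis by (simp add: algebra_simps power2_eq_square)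
  qed
  also have "2 * C = 4 / (1 - pmax)" by (simp add: C_def)
  finally have v: "(\<Sum>d\<in>D. \<Sum>d'\<in>D. prob (returns c d \<inter> returns c d')) \<le> S\<^sup>2 * (1 + 4 / (1 - pmax))" .
  have e: "pmin * S \<le> (\<Sum>d\<in>D. prob (returns c d))"
    unfolding S_def sum_distrib_left returns_def
  proof (intro sum_mono prob_recurrence_ge c)
    fix d assume "d \<in> D"
    then have d: "d \<in> return_times c N" using D by auto
    then show "pmax ^ (fst d div 4) < c (fst d)" by (auto simp: return_times_def)
    show "snd d < fst d" by (rule return_times_pos(2)[OF d c])
  qed
  have "S \<noteq> 0" "0 \<le> S" using S by (auto simp: S_def)
  moreover have B: "0 < 1 + 4 / (1 - pmax)" using pmax_less_1 by (intro add_pos_pos) auto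
  ultimately have "(pmin * S)\<^sup>2 / (S\<^sup>2 * (1 + 4 / (1 - pmax))) \<le> prob (\<Union>d\<in>D. returns c d)"
    using D c pmin_pos
    by (intro prob_UN_ge_second_moment[OF D(1) _ _ e _ v] sets_returns) auto
  then show ?thesis
    using \<open>S \<noteq> 0\<close> by (simp add: hit_bound_def power_mult_distrib)
qed

text \<open>A return event reads letters from \<open>l\<close> on only, and l >= n div 4 >= m once n
  >= 4 m. Dropping the unions with N < 4 m does not change the intersection, since the unions
  decrease in \<open>N\<close>.\<close>

lemma limsup_returns_tail:
  assumes c: "\<And>n. c n \<le> 1"
  shows "(\<Inter>N. \<Union>d\<in>return_times c N. returns c d) \<in> tail_events coordinate_sets"
  unfolding tail_events_def
proof
  fix m
  let ?S = "sigma_sets (space M) (\<Union>(coordinate_sets ` {m..}))"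
  let ?U = "\<lambda>N. \<Union>d\<in>return_times c N. returns c d"
  interpret S: sigma_algebra "space M" ?S
    by (rule sigma_algebra_sigma_sets) auto
  have "returns c d \<in> ?S" if d: "d \<in> return_times c N" "4 * m \<le> N" for d N
  proof -
    have "N \<le> fst d" "fst d div 4 \<le> snd d" using d(1) by (auto simp: return_times_def)
    with d(2) have "m \<le> snd d" by linarith
    then have "{snd d..<fst d + fst d div 4} \<subseteq> {m..}" by auto
    moreover have "snd d \<le> fst d" using return_times_pos(2)[OF d(1) c] by simp
    ultimately show ?thesis
      using determined_on_sigma_sets[OF finite_atLeastLessThan determined_on_recurrence]
      by (fastforce simp: returns_def)
  qed
  then have "?U N \<in> ?S" if "4 * m \<le> N" for N
    using that by (intro S.countable_UN'' countableI_type) auto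
  then have "(\<Inter>N\<in>{4 * m..}. ?U N) \<in> ?S"
    by (intro S.countable_INT) auto
  also have "(\<Inter>N\<in>{4 * m..}. ?U N) = (\<Inter>N. ?U N)"
  proof (intro equalityI subsetI INT_I)
    fix x N assume x: "x \<in> (\<Inter>N\<in>{4 * m..}. ?U N)"
    have "x \<in> ?U (max N (4 * m))" by (rule INT_D[OF x]) simp
    then show "x \<in> ?U N" by (auto simp: return_times_def)
  qed auto
  finally show "(\<Inter>N. ?U N) \<in> ?S" .
qed

theorem prob_limsup_returns:
  assumes c: "\<And>n. 0 \<le> c n" "\<And>n. c n \<le> 1"
    and div: "\<not> summable (\<lambda>n. if pmax ^ (n div 4) < c n then real n * c n else 0)"
  shows "prob (\<Inter>N. \<Union>d\<in>return_times c N. returns c d) = 1"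
proof -
  let ?U = "\<lambda>N. \<Union>d\<in>return_times c N. returns c d"
  let ?h = "\<lambda>n. if pmax ^ (n div 4) < c n then real n * c n else 0"
  have U: "?U N \<in> sets M" for N
    using sets_returns[OF _ c(2)] by (intro sets.countable_UN'' countableI_type) auto
  have "hit_bound \<le> prob (?U N)" for N
  proof -
    have "\<not> summable (\<lambda>n. ?h (n + N))" using div by (subst summable_iff_shift)
    \<comment> \<open>The threshold 4 makes up for keeping only the positions from
      \<open>n div 4\<close> to \<open>n div 2\<close>, at least n / 4 in number, so that the
      selected mass is at least 1.\<close>
    then have "\<not> (\<forall>m. (\<Sum>n<m. ?h (n + N)) \<le> 4)"
      using c(1) by (auto intro: summableI_nonneg_bounded)
    then obtain m where m: "4 < (\<Sum>n<m. ?h (n + N))" by (auto simp: not_le)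
    let ?G = "{n\<in>{N..<m + N}. pmax ^ (n div 4) < c n}"
    let ?D = "SIGMA n:?G. {n div 4..n div 2}"
    have "(\<Sum>n<m. ?h (n + N)) = (\<Sum>n\<in>{N..<m + N}. ?h n)"
      by (rule sum.reindex_bij_witness[of _ "\<lambda>n. n - N" "\<lambda>n. n + N"]) auto
    also have "\<dots> = (\<Sum>n\<in>?G. real n * c n)" by (rule sum.inter_filter[symmetric]) simp
    also have "\<dots> \<le> (\<Sum>n\<in>?G. 4 * (real (card {n div 4..n div 2}) * c n))"
    proof (rule sum_mono)
      fix n
      have "n \<le> 4 * card {n div 4..n div 2}" by simp
      then have "real n \<le> 4 * real (card {n div 4..n div 2})" by linarith
      then show "real n * c n \<le> 4 * (real (card {n div 4..n div 2}) * c n)"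
        using mult_right_mono[OF _ c(1)[of n]] by (metis mult.assoc)
    qed
    also have "\<dots> = 4 * (\<Sum>n\<in>?G. \<Sum>l\<in>{n div 4..n div 2}. c n)"
      by (simp only: sum_distrib_left[symmetric] sum_constant)
    also have "(\<Sum>n\<in>?G. \<Sum>l\<in>{n div 4..n div 2}. c n) = (\<Sum>d\<in>?D. c (fst d))"
      by (subst sum.Sigma) (simp_all add: split_def)
    finally have "1 \<le> (\<Sum>d\<in>?D. c (fst d))" using m by linarith
    moreover have "?D \<subseteq> return_times c N" by (auto simp: return_times_def)
    ultimately have "hit_bound \<le> prob (\<Union>d\<in>?D. returns c d)"
      using c(2) by (intro prob_UN_returns_ge[of _ c N]) auto
    also have "\<dots> \<le> prob (?U N)"
      using \<open>?D \<subseteq> return_times c N\<close> U by (intro finite_measure_mono) blast+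
    finally show ?thesis .
  qed
  moreover have "(\<lambda>N. prob (?U N)) \<longlonglongrightarrow> prob (\<Inter>N. ?U N)"
  proof (rule finite_Lim_measure_decseq)
    have "return_times c n \<subseteq> return_times c m" if "m \<le> n" for m n
      using that by (auto simp: return_times_def)
    then show "decseq ?U" unfolding decseq_def by (blast intro: UN_mono)
  qed (use U in auto)
  ultimately have "hit_bound \<le> prob (\<Inter>N. ?U N)" by (intro LIMSEQ_le_const) auto
  then show ?thesis
    using kolmogorov_0_1_law[OF sigma_algebra_coordinate_sets indep_coordinate_sets
        limsup_returns_tail[of c, OF c(2)]] hit_bound_pos by linarith
qed

end

section \<open>Self-similar sets and their coding\<close>

lemma ratio_eq:
  fixes f :: "'v::euclidean_space \<Rightarrow> 'v"
  assumes "similarity_ratio r f"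
  shows "ratio f = r"
  unfolding ratio_def
proof (rule the_equality)
  fix r' assume r': "similarity_ratio r' f"
  obtain b :: 'v where "b \<in> Basis" using nonempty_Basis by blast
  then have "b \<noteq> 0" by auto
  moreover have "r' * dist b 0 = r * dist b 0"
    using assms r' unfolding similarity_ratio_def by metis
  ultimately show "r' = r" by simp
qed (rule assms)

lemma diameter_image_similar:
  fixes f :: "'v::real_normed_vector \<Rightarrow> 'w::real_normed_vector"
  assumes f: "\<And>x y. dist (f x) (f y) = r * dist x y" and "0 < r" "bounded S"
  shows "diameter (f ` S) = r * diameter S"
proof (cases "S = {}")
  case False
  have upper: "dist x y \<le> r * diameter S" if xy: "x \<in> f ` S" "y \<in> f ` S" for x y
    using xy f \<open>0 < r\<close> diameter_bounded_bound[OF \<open>bounded S\<close>] by auto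
  have b: "bounded (f ` S)"
    using upper unfolding bounded_two_points by blast
  have "diameter (f ` S) \<le> r * diameter S"
    using False upper by (intro diameter_le) (auto simp: dist_norm)
  moreover have "diameter S \<le> diameter (f ` S) / r"
  proof (rule diameter_le)
    fix x y assume "x \<in> S" "y \<in> S"
    then have "r * dist x y \<le> diameter (f ` S)"
      using diameter_bounded_bound[OF b, of "f x" "f y"] f by simp
    then show "norm (x - y) \<le> diameter (f ` S) / r"
      using \<open>0 < r\<close> by (simp add: field_simps dist_norm)
  qed (use False in simp)
  ultimately show ?thesis using \<open>0 < r\<close> by (simp add: field_simps)
qed (simp add: diameter_def)

locale ifs =
  fixes \<Phi> :: "'a::finite \<Rightarrow> 'v::euclidean_space \<Rightarrow> 'v"
  assumes ifs: "IFS \<Phi>"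
begin

abbreviation r :: "'a \<Rightarrow> real" where "r a \<equiv> ratio (\<Phi> a)"

lemma similarity_ratio_r: "similarity_ratio (r a) (\<Phi> a)"
  using ifs ratio_eq[of _ "\<Phi> a"] unfolding IFS_def similarity_def by metis

lemma r_pos: "0 < r a" and r_less_1: "r a < 1"
  and dist_map: "dist (\<Phi> a x) (\<Phi> a y) = r a * dist x y"
  using similarity_ratio_r[of a] by (auto simp: similarity_ratio_def)

definition rmax :: real where "rmax = Max (range r)"

lemma r_le_rmax: "r a \<le> rmax" and rmax_less_1: "rmax < 1"
  using r_less_1 by (auto simp: rmax_def)

lemma rmax_pos: "0 < rmax"
  using r_pos r_le_rmax less_le_trans by blast

definition word_ratio :: "'a list \<Rightarrow> real" where
  "word_ratio w = prod_list (map r w)"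

lemma word_ratio_pos: "0 < word_ratio w"
  by (induction w) (auto simp: word_ratio_def r_pos)

lemma word_ratio_append: "word_ratio (u @ v) = word_ratio u * word_ratio v"
  by (simp add: word_ratio_def)

lemma word_ratio_le: "word_ratio w \<le> rmax ^ length w"
proof (induction w)
  case (Cons a w)
  have "r a * word_ratio w \<le> rmax * rmax ^ length w"
    using Cons r_le_rmax[of a] r_pos[of a] word_ratio_pos[of w] rmax_pos by (intro mult_mono) auto
  then show ?case by (simp add: word_ratio_def)
qed (simp add: word_ratio_def)

lemma dist_word_map: "dist (word_map \<Phi> w x) (word_map \<Phi> w y) = word_ratio w * dist x y"
  by (induction w) (auto simp: word_ratio_def dist_map)

text \<open>The solution t of t = rmax t + max |\<Phi> a 0|, so every map sends the closed ball of
  radius t about 0 into itself.\<close>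

definition orbit_bound :: real where
  "orbit_bound = Max (range (\<lambda>a. norm (\<Phi> a 0))) / (1 - rmax)"

lemma orbit_bound_nonneg: "0 \<le> orbit_bound"
proof -
  have "norm (\<Phi> undefined 0) \<le> Max (range (\<lambda>a. norm (\<Phi> a 0)))" by simp
  then show ?thesis
    using rmax_less_1 norm_ge_zero[of "\<Phi> undefined 0"] unfolding orbit_bound_def
    by (intro divide_nonneg_pos) linarith+
qed

lemma norm_word_map_le: "norm (word_map \<Phi> w 0) \<le> orbit_bound"
proof (induction w)
  case (Cons a w)
  have "norm (\<Phi> a (word_map \<Phi> w 0)) \<le> dist (\<Phi> a (word_map \<Phi> w 0)) (\<Phi> a 0) + norm (\<Phi> a 0)"
    by (metis dist_0_norm dist_commute dist_triangle add.commute)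
  also have "\<dots> \<le> rmax * orbit_bound + Max (range (\<lambda>a. norm (\<Phi> a 0)))"
    unfolding dist_map using Cons r_le_rmax[of a] r_pos[of a]
    by (intro add_mono mult_mono) (auto simp: dist_norm rmax_pos less_imp_le)
  also have "\<dots> = orbit_bound"
    using rmax_less_1 by (simp add: orbit_bound_def field_simps)
  finally show ?case by simp
qed (simp add: orbit_bound_nonneg)

lemma map_upt_add: "map x [0..<n + m] = map x [0..<n] @ map (suffix n x) [0..<m]"
  by (induction m) auto

lemma power_rmax_tendsto: "(\<lambda>n. rmax ^ n * C) \<longlonglongrightarrow> 0"
  using rmax_pos rmax_less_1 by (intro tendsto_mult_left_zero LIMSEQ_realpow_zero) auto

lemma coding_tendsto_0: "(\<lambda>n. word_map \<Phi> (map x [0..<n]) 0) \<longlonglongrightarrow> coding \<Phi> x"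
proof -
  let ?s = "\<lambda>n. word_map \<Phi> (map x [0..<n]) 0"
  have d: "dist (?s n) (?s m) \<le> rmax ^ n * orbit_bound" if le: "n \<le> m" for n m
  proof -
    obtain k where m: "m = n + k" using le le_Suc_ex by blast
    have "dist (?s n) (?s m)
        = word_ratio (map x [0..<n]) * norm (word_map \<Phi> (map (suffix n x) [0..<k]) 0)"
      by (simp add: m map_upt_add dist_word_map del: upt_Suc)
    also have "\<dots> \<le> rmax ^ n * orbit_bound"
      using word_ratio_le[of "map x [0..<n]"] norm_word_map_le rmax_pos
      by (intro mult_mono) auto
    finally show ?thesis .
  qed
  have "Cauchy ?s"
  proof (rule metric_CauchyI)
    fix e :: real assume "0 < e"
    then obtain N where "rmax ^ N * orbit_bound < e / 2"
      using power_rmax_tendsto[of orbit_bound, THEN order_tendstoD(2), of "e / 2"]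
      by (auto simp: eventually_sequentially)
    then have "dist (?s m) (?s n) < e" if "N \<le> m" "N \<le> n" for m n
      using d[OF that(1)] d[OF that(2)] dist_triangle3[of "?s m" "?s n" "?s N"] by linarith
    then show "\<exists>N. \<forall>m\<ge>N. \<forall>n\<ge>N. dist (?s m) (?s n) < e" by blast
  qed
  then show ?thesis
    unfolding coding_def using Cauchy_convergent_iff convergent_LIMSEQ_iff by blast
qed

lemma coding_eqI:
  assumes "\<And>n. z = word_map \<Phi> (map x [0..<n]) (u n)" "\<And>n. norm (u n) \<le> C"
  shows "coding \<Phi> x = z"
proof -
  let ?s = "\<lambda>n. word_map \<Phi> (map x [0..<n]) 0"
  have "dist (?s n) z \<le> rmax ^ n * C" for n
  proof -
    have "dist (?s n) z = word_ratio (map x [0..<n]) * norm (u n)"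
      by (subst assms(1)[of n], subst dist_word_map) simp
    also have "\<dots> \<le> rmax ^ n * C"
      using word_ratio_le[of "map x [0..<n]"] assms(2) rmax_pos by (intro mult_mono) auto
    finally show ?thesis .
  qed
  then have "(\<lambda>n. dist (?s n) z) \<longlonglongrightarrow> 0"
    by (intro tendsto_sandwich[OF _ _ tendsto_const power_rmax_tendsto[of C]]) auto
  then have "?s \<longlonglongrightarrow> z" by (rule tendstoI[OF order_tendstoD(2)])
  then show ?thesis using coding_tendsto_0 LIMSEQ_unique by blast
qed

lemma coding_tendsto: "(\<lambda>n. word_map \<Phi> (map x [0..<n]) y) \<longlonglongrightarrow> coding \<Phi> x"
proof -
  have "(\<lambda>n. dist (word_map \<Phi> (map x [0..<n]) y) (word_map \<Phi> (map x [0..<n]) 0)) \<longlonglongrightarrow> 0"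
  proof (rule tendsto_sandwich[OF _ _ tendsto_const power_rmax_tendsto[of "norm y"]])
    show "\<forall>\<^sub>F n in sequentially.
        dist (word_map \<Phi> (map x [0..<n]) y) (word_map \<Phi> (map x [0..<n]) 0) \<le> rmax ^ n * norm y"
    proof (intro always_eventually allI)
      fix n
      show "dist (word_map \<Phi> (map x [0..<n]) y) (word_map \<Phi> (map x [0..<n]) 0) \<le> rmax ^ n * norm y"
        using word_ratio_le[of "map x [0..<n]"] by (simp add: dist_word_map mult_right_mono)
    qed
  qed simp
  then have "(\<lambda>n. word_map \<Phi> (map x [0..<n]) y - word_map \<Phi> (map x [0..<n]) 0) \<longlonglongrightarrow> 0"
    by (simp add: dist_norm tendsto_norm_zero_iff)
  from tendsto_add[OF this coding_tendsto_0[of x]] show ?thesis by simp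
qed

lemma norm_coding_le: "norm (coding \<Phi> x) \<le> orbit_bound"
  by (rule LIMSEQ_le_const2[OF tendsto_norm[OF coding_tendsto_0]]) (auto simp: norm_word_map_le)

lemma word_map_tendsto:
  assumes "u \<longlonglongrightarrow> z"
  shows "(\<lambda>n. word_map \<Phi> w (u n)) \<longlonglongrightarrow> word_map \<Phi> w z"
proof -
  have "(\<lambda>n. dist (u n) z) \<longlonglongrightarrow> 0" using assms tendsto_dist_iff by blast
  then have "(\<lambda>n. word_ratio w * dist (u n) z) \<longlonglongrightarrow> 0" by (rule tendsto_mult_right_zero)
  then have "(\<lambda>n. dist (word_map \<Phi> w (u n)) (word_map \<Phi> w z)) \<longlonglongrightarrow> 0" by (simp only: dist_word_map)
  then show ?thesis by (rule tendsto_dist_iff[THEN iffD2])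
qed

lemma coding_suffix: "coding \<Phi> x = word_map \<Phi> (map x [0..<n]) (coding \<Phi> (suffix n x))"
proof -
  have "(\<lambda>m. word_map \<Phi> (map x [0..<n]) (word_map \<Phi> (map (suffix n x) [0..<m]) 0))
      \<longlonglongrightarrow> word_map \<Phi> (map x [0..<n]) (coding \<Phi> (suffix n x))"
    by (intro word_map_tendsto coding_tendsto_0)
  moreover have "(\<lambda>m. word_map \<Phi> (map x [0..<m + n]) 0) \<longlonglongrightarrow> coding \<Phi> x"
    by (rule LIMSEQ_ignore_initial_segment[OF coding_tendsto_0])
  then have "(\<lambda>m. word_map \<Phi> (map x [0..<n]) (word_map \<Phi> (map (suffix n x) [0..<m]) 0))
      \<longlonglongrightarrow> coding \<Phi> x"
    by (simp add: add.commute[of _ n] map_upt_add del: upt_Suc)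
  ultimately show ?thesis using LIMSEQ_unique by blast
qed

lemma map_coding: "\<Phi> a (coding \<Phi> x) = coding \<Phi> (case_nat a x)"
  using coding_suffix[of "case_nat a x" 1] by (simp add: suffix_def)

lemma range_coding_invariant: "range (coding \<Phi>) = (\<Union>a. \<Phi> a ` range (coding \<Phi>))"
proof (intro equalityI subsetI)
  fix z assume "z \<in> range (coding \<Phi>)"
  then obtain x where "z = coding \<Phi> x" by auto
  then have "z = \<Phi> (x 0) (coding \<Phi> (suffix 1 x))" using coding_suffix[of x 1] by simp
  then show "z \<in> (\<Union>a. \<Phi> a ` range (coding \<Phi>))" by blast
qed (auto simp: map_coding)

lemma continuous_map: "continuous_on S (\<Phi> a)"
proof (rule lipschitz_on_continuous_on)
  show "(r a)-lipschitz_on S (\<Phi> a)"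
    by (rule lipschitz_onI) (auto simp: dist_map less_imp_le[OF r_pos])
qed

lemma compact_closure_range: "compact (closure (range (coding \<Phi>)))"
  using norm_coding_le by (auto simp: compact_closure bounded_iff)

lemma closure_range_invariant:
  "closure (range (coding \<Phi>)) = (\<Union>a. \<Phi> a ` closure (range (coding \<Phi>)))"
proof -
  let ?A = "range (coding \<Phi>)"
  have im: "closure (\<Phi> a ` ?A) = \<Phi> a ` closure ?A" for a
  proof (rule antisym)
    show "closure (\<Phi> a ` ?A) \<subseteq> \<Phi> a ` closure ?A"
      by (rule closure_minimal[OF image_mono[OF closure_subset] compact_imp_closed[OF
            compact_continuous_image[OF continuous_map compact_closure_range]]])
    show "\<Phi> a ` closure ?A \<subseteq> closure (\<Phi> a ` ?A)"
      by (rule image_closure_subset[OF continuous_map closed_closure closure_subset])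
  qed
  have "closure ?A = closure (\<Union>a. \<Phi> a ` ?A)"
    by (rule arg_cong[OF range_coding_invariant])
  also have "\<dots> = (\<Union>a. closure (\<Phi> a ` ?A))"
  proof (rule antisym)
    show "closure (\<Union>a. \<Phi> a ` ?A) \<subseteq> (\<Union>a. closure (\<Phi> a ` ?A))"
      by (intro closure_minimal closed_UN UN_mono closure_subset) auto
    show "(\<Union>a. closure (\<Phi> a ` ?A)) \<subseteq> closure (\<Union>a. \<Phi> a ` ?A)"
      by (intro UN_least closure_mono UN_upper) auto
  qed
  finally show ?thesis unfolding im .
qed

text \<open>One inclusion pushes a point of \<open>Y\<close> along a code and takes the limit in the
  closed set \<open>Y\<close>. For the other, preimages in \<open>Y\<close> are chosen again and
  again; the letters used form a code of the given point.\<close>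

lemma invariant_compact_eq_range:
  assumes Y: "compact Y" "Y \<noteq> {}" "Y = (\<Union>a. \<Phi> a ` Y)"
  shows "Y = range (coding \<Phi>)"
proof (intro equalityI subsetI)
  fix z assume "z \<in> range (coding \<Phi>)"
  then obtain x where z: "z = coding \<Phi> x" by auto
  obtain y where "y \<in> Y" using Y(2) by blast
  have "word_map \<Phi> w y \<in> Y" for w
  proof (induction w)
    case (Cons a w)
    then show ?case by (subst Y(3)) auto
  qed (simp add: \<open>y \<in> Y\<close>)
  then show "z \<in> Y"
    unfolding z by (intro Lim_in_closed_set[OF compact_imp_closed[OF Y(1)] _ _ coding_tendsto[of x y]]) auto
next
  fix y assume y: "y \<in> Y"
  have "\<exists>a. \<exists>v\<in>Y. u = \<Phi> a v" if "u \<in> Y" for u using that Y(3) by blast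
  then obtain letter pre where
    pre: "\<And>u. u \<in> Y \<Longrightarrow> pre u \<in> Y \<and> u = \<Phi> (letter u) (pre u)" by metis
  have in_Y: "(pre ^^ n) y \<in> Y" for n by (induction n) (auto simp: y pre)
  let ?x = "\<lambda>n. letter ((pre ^^ n) y)"
  have "y = word_map \<Phi> (map ?x [0..<n]) ((pre ^^ n) y)" for n
  proof (induction n)
    case (Suc n)
    have "\<Phi> (?x n) ((pre ^^ Suc n) y) = (pre ^^ n) y" using pre[OF in_Y[of n]] by simp
    with Suc show ?case by simp
  qed simp
  moreover obtain C where "\<And>v. v \<in> Y \<Longrightarrow> norm v \<le> C"
    using compact_imp_bounded[OF Y(1)] by (auto simp: bounded_iff)
  ultimately have "coding \<Phi> ?x = y" using in_Y by (intro coding_eqI[of y ?x "\<lambda>n. (pre ^^ n) y" C]) auto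
  then show "y \<in> range (coding \<Phi>)" by (metis rangeI)
qed

text \<open>Uniqueness applies to the closure of the range, which is compact and invariant, so the
  range equals its closure. No topology on the sequence space is involved.\<close>

lemma compact_range_coding: "compact (range (coding \<Phi>))"
  using invariant_compact_eq_range[OF compact_closure_range _ closure_range_invariant]
    compact_closure_range by simp

lemma self_similar_set_eq: "self_similar_set \<Phi> = range (coding \<Phi>)"
  unfolding self_similar_set_def
proof (rule the_equality)
  show "compact (range (coding \<Phi>)) \<and> range (coding \<Phi>) \<noteq> {}
      \<and> range (coding \<Phi>) = (\<Union>a. \<Phi> a ` range (coding \<Phi>))"
    using compact_range_coding range_coding_invariant by blast
qed (use invariant_compact_eq_range in blast)

abbreviation diam :: real where "diam \<equiv> diameter (self_similar_set \<Phi>)"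

lemma bounded_self_similar_set: "bounded (self_similar_set \<Phi>)"
  by (simp add: self_similar_set_eq compact_imp_bounded compact_range_coding)

lemma diameter_cylinder: "diameter (cylinder_set \<Phi> w) = word_ratio w * diam"
  unfolding cylinder_set_def
  by (intro diameter_image_similar dist_word_map word_ratio_pos bounded_self_similar_set)

lemma dist_coding_le:
  assumes "\<And>i. i < n \<Longrightarrow> x i = y i"
  shows "dist (coding \<Phi> x) (coding \<Phi> y) \<le> word_ratio (map x [0..<n]) * diam"
proof -
  have "map x [0..<n] = map y [0..<n]" using assms by simp
  then have "dist (coding \<Phi> x) (coding \<Phi> y)
      = word_ratio (map x [0..<n]) * dist (coding \<Phi> (suffix n x)) (coding \<Phi> (suffix n y))"
    using coding_suffix[of x n] coding_suffix[of y n] dist_word_map by metis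
  also have "\<dots> \<le> word_ratio (map x [0..<n]) * diam"
    using diameter_bounded_bound[OF bounded_self_similar_set] word_ratio_pos
    by (intro mult_left_mono) (auto simp: self_similar_set_eq intro: less_imp_le)
  finally show ?thesis .
qed

lemma diam_single_letter:
  assumes "\<And>a b :: 'a. a = b"
  shows "diam = 0"
proof -
  have "x = undefined" for x :: "nat \<Rightarrow> 'a" using assms by blast
  then have "coding \<Phi> x = coding \<Phi> undefined" for x by (rule arg_cong)
  then have "self_similar_set \<Phi> = {coding \<Phi> undefined}"
    unfolding self_similar_set_eq by auto
  then show ?thesis by simp
qed

section \<open>The similarity dimension and the weights\<close>

lemma similarity_dim_exists: "\<exists>!s. (\<Sum>a\<in>UNIV. r a powr s) = 1"
proof -
  let ?f = "\<lambda>s. \<Sum>a\<in>UNIV. r a powr s"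
  have mono: "?f t < ?f s" if "s < t" for s t
    using that r_pos r_less_1 by (intro sum_strict_mono powr_less_mono') auto
  \<comment> \<open>The value at 0 is the number of letters, hence at least 1; a large integer
    exponent brings the sum below 1, and strict monotonicity leaves a single solution in
    between.\<close>
  have f0: "1 \<le> ?f 0" using r_pos by (simp add: less_imp_neq[symmetric] Suc_le_eq)
  obtain n where n: "rmax ^ n * real CARD('a) < 1"
    using power_rmax_tendsto[of "real CARD('a)", THEN order_tendstoD(2), of 1]
    by (auto simp: eventually_sequentially)
  have "?f (real n) \<le> (\<Sum>a\<in>(UNIV::'a set). rmax ^ n)"
    using r_pos r_le_rmax by (intro sum_mono) (auto simp: powr_realpow less_imp_le intro!: power_mono)
  then have fn: "?f (real n) \<le> 1" using n by (simp add: mult.commute)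
  have "continuous_on {0..real n} ?f" using r_pos by (intro continuous_intros) (auto simp: less_imp_neq[symmetric])
  then obtain s where "?f s = 1" using IVT2'[of ?f "real n" 1 0] fn f0 by auto
  moreover have "s' = s" if "?f s' = 1" for s'
    using mono[of s s'] mono[of s' s] that \<open>?f s = 1\<close> by (cases s s' rule: linorder_cases) auto
  ultimately show ?thesis by blast
qed

lemma sum_weight: "(\<Sum>a\<in>UNIV. weight \<Phi> a) = 1"
  using theI'[OF similarity_dim_exists] by (simp add: weight_def similarity_dim_def)

text \<open>With an exponent <= 0 every weight would be at least 1, and two letters would exceed the
  total 1.\<close>

lemma similarity_dim_pos:
  assumes "(a :: 'a) \<noteq> b"
  shows "0 < similarity_dim \<Phi>"
proof (rule ccontr)
  assume "\<not> 0 < similarity_dim \<Phi>"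
  then have "r c powr 0 \<le> r c powr similarity_dim \<Phi>" for c
    using r_pos[of c] r_less_1[of c] by (intro powr_mono') auto
  then have "1 \<le> weight \<Phi> c" for c
    using r_pos[of c] unfolding weight_def by (metis less_irrefl powr_zero_eq_one)
  then have "weight \<Phi> a + weight \<Phi> b \<ge> 2" by (metis add_mono one_add_one)
  moreover have "weight \<Phi> a + weight \<Phi> b = (\<Sum>c\<in>{a, b}. weight \<Phi> c)" using assms by simp
  moreover have "\<dots> \<le> (\<Sum>c\<in>UNIV. weight \<Phi> c)"
    by (intro sum_mono2) (auto simp: weight_def)
  ultimately show False using sum_weight by linarith
qed

lemma bernoulli_scheme_weight:
  assumes "(a :: 'a) \<noteq> b"
  shows "bernoulli_scheme (weight \<Phi>)"
proof
  show "0 < weight \<Phi> c" for c using r_pos[of c] by (simp add: weight_def)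
  show "weight \<Phi> c < 1" for c
    using powr_less_mono'[of "r c" 0 "similarity_dim \<Phi>"] r_pos[of c] r_less_1[of c]
      similarity_dim_pos[OF assms] by (simp add: weight_def less_imp_neq[symmetric])
qed (rule sum_weight)

end

section \<open>The covering bound for the Hausdorff measure\<close>

text \<open>A radius <= 0 gives the empty ball, of gauge 0, so the value 0 of
  \<open>0 powr 0\<close> on the right is harmless when s = 0.\<close>

lemma hausdorff_gauge_ball_le:
  fixes z :: "'v::euclidean_space"
  assumes "0 \<le> s"
  shows "hausdorff_gauge s (ball z \<rho>) \<le> ennreal (2 powr s * \<rho> powr s)"
proof (cases "\<rho> \<le> 0")
  case True
  then show ?thesis by (simp add: hausdorff_gauge_def ball_empty)
next
  case False
  then have "2 powr s * \<rho> powr s = (2 * \<rho>) powr s" by (simp add: powr_mult)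
  with False assms show ?thesis by (simp add: hausdorff_gauge_def)
qed

lemma finite_words: "finite {w :: 'a::finite list. length w = n}"
  using finite_lists_length_eq[of "UNIV :: 'a set" n] by simp

text \<open>A pair (w, l) indexes a ball. After grouping by length, each word of length n + 1 admits
  the n + 1 positions l = 0, ..., n; this is the origin of the linear factor in the series.\<close>

lemma nn_integral_words_le:
  fixes h :: "'a::finite list \<times> nat \<Rightarrow> ennreal"
  assumes zero: "\<And>w l. length w < N \<or> length w \<le> l \<Longrightarrow> h (w, l) = 0" and "0 < N"
    and F: "\<And>w l. h (w, l) \<le> ennreal (F w)"
  shows "(\<integral>\<^sup>+z. h z \<partial>count_space UNIV)
    \<le> (\<Sum>n. if N \<le> Suc n then \<Sum>w\<in>{w. length w = Suc n}. ennreal (real (Suc n) * F w) else 0)"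
proof -
  let ?t = "\<lambda>n. if N \<le> Suc n then \<Sum>w\<in>{w :: 'a list. length w = Suc n}. ennreal (real (Suc n) * F w) else 0"
  let ?I = "\<lambda>n z. h z * indicator {z. length (fst z) = Suc n} z"
  have "h z = (\<Sum>n. ?I n z)" for z
  proof -
    have "(\<Sum>n. ?I n z) = (\<Sum>n\<in>{length (fst z) - 1}. ?I n z)"
      by (rule suminf_finite) (auto simp: indicator_def)
    also have "\<dots> = h z"
      using zero[of "fst z" "snd z"] \<open>0 < N\<close> prod.collapse[of z]
      by (cases "fst z") (auto simp: indicator_def)
    finally show ?thesis by simp
  qed
  then have "(\<integral>\<^sup>+z. h z \<partial>count_space UNIV) = (\<integral>\<^sup>+z. (\<Sum>n. ?I n z) \<partial>count_space UNIV)" by simp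
  also have "\<dots> = (\<Sum>n. \<integral>\<^sup>+z. ?I n z \<partial>count_space UNIV)" by (rule nn_integral_suminf) simp
  also have "\<dots> \<le> (\<Sum>n. ?t n)"
  proof (rule suminf_le)
    fix n
    let ?A = "{w :: 'a list. length w = Suc n} \<times> {..<Suc n}"
    have "(\<integral>\<^sup>+z. ?I n z \<partial>count_space UNIV) = (\<Sum>z\<in>?A. ?I n z)"
    proof (rule nn_integral_count_space')
      fix z assume "z \<notin> ?A"
      then show "?I n z = 0"
        using zero[of "fst z" "snd z"] by (cases z) (auto simp: indicator_def not_less)
    qed (auto simp: finite_words)
    also have "\<dots> \<le> ?t n"
    proof (cases "N \<le> Suc n")
      case True
      have "(\<Sum>z\<in>?A. ?I n z) \<le> (\<Sum>z\<in>?A. ennreal (F (fst z)))"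
        using F by (intro sum_mono) (auto simp: indicator_def)
      also have "\<dots> = (\<Sum>w\<in>{w. length w = Suc n}. \<Sum>l<Suc n. ennreal (F w))"
        by (simp only: sum.cartesian_product split_def)
      also have "\<dots> = ?t n"
        using True by (simp add: ennreal_mult' ennreal_of_nat_eq_real_of_nat)
      finally show ?thesis .
    next
      case False
      then have "?I n z = 0" if "z \<in> ?A" for z
        using that zero[of "fst z" "snd z"] by (auto simp: indicator_def)
      then have "(\<Sum>z\<in>?A. ?I n z) = 0" by (rule sum.neutral[OF ballI])
      with False show ?thesis by simp
    qed
    finally show "(\<integral>\<^sup>+z. ?I n z \<partial>count_space UNIV) \<le> ?t n" .
  qed auto
  finally show ?thesis .
qed

lemma suminf_enumerate:
  fixes h :: "'b::countable \<Rightarrow> ennreal"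
  shows "(\<Sum>i. if i \<in> range (to_nat :: 'b \<Rightarrow> nat) then h (from_nat i) else 0)
    = (\<integral>\<^sup>+z. h z \<partial>count_space UNIV)"
proof -
  let ?R = "range (to_nat :: 'b \<Rightarrow> nat)"
  have "(\<Sum>i. if i \<in> ?R then h (from_nat i) else 0)
      = (\<integral>\<^sup>+i. (if i \<in> ?R then h (from_nat i) else 0) \<partial>count_space UNIV)"
    by (rule nn_integral_count_space_nat[symmetric])
  also have "\<dots> = (\<integral>\<^sup>+i. h (from_nat i) * indicator ?R i \<partial>count_space UNIV)"
    by (intro nn_integral_cong) (auto simp: indicator_def)
  also have "\<dots> = (\<integral>\<^sup>+i. h (from_nat i) \<partial>count_space ?R)"
    by (rule nn_integral_count_space_indicator[symmetric]) simp
  also have "\<dots> = (\<integral>\<^sup>+z. h (from_nat (to_nat (z :: 'b))) \<partial>count_space UNIV)"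
    by (rule nn_integral_bij_count_space[symmetric]) (simp add: bij_betw_def)
  finally show ?thesis by simp
qed

text \<open>Summability forces the radii to 0 uniformly in the length, so the balls of all
  sufficiently long words form an admissible cover at every scale; its total gauge is at most 2^s
  times a tail of the series.\<close>

theorem hausdorff_measure_W_set_eq_0:
  fixes \<Phi> :: "'a::finite \<Rightarrow> 'v::euclidean_space \<Rightarrow> 'v"
  assumes s: "0 \<le> s" and conv: "word_series s \<Psi> < \<infinity>"
  shows "hausdorff_measure s (W_set \<Phi> \<Psi>) = 0"
proof -
  define a where "a n = (\<Sum>w\<in>{w :: 'a list. length w = Suc n}. real (Suc n) * \<Psi> w powr s)" for n
  have a_nonneg: "0 \<le> a n" for n by (auto simp: a_def intro!: sum_nonneg)
  have "word_series s \<Psi> = (\<Sum>n. ennreal (a n))"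
    unfolding word_series_def a_def by (intro suminf_cong sum_ennreal) simp
  with conv have a: "summable a"
    using a_nonneg by (intro summable_suminf_not_top) auto
  then have a_lim: "a \<longlonglongrightarrow> 0" by (rule summable_LIMSEQ_zero)
  have a_ge: "\<Psi> w powr s \<le> a n" if "length w = Suc n" for w n
  proof -
    have "real (Suc n) * \<Psi> w powr s \<le> a n"
      unfolding a_def using that by (intro member_le_sum finite_words) auto
    moreover have "1 * \<Psi> w powr s \<le> real (Suc n) * \<Psi> w powr s" by (intro mult_right_mono) auto
    ultimately show ?thesis by simp
  qed
  \<comment> \<open>This includes s = 0: a word with \<open>\<Psi> w\<close> above
    \<open>\<epsilon>\<close> makes its term of \<open>a\<close> at least 1, whereas
    \<open>a\<close> eventually stays below 1.\<close>
  have small: "\<exists>N. \<forall>w. N < length w \<longrightarrow> \<Psi> w \<le> \<epsilon>" if "0 < \<epsilon>" for \<epsilon>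
  proof -
    have "0 < \<epsilon> powr s" using that by simp
    then obtain N where N: "\<And>n. N \<le> n \<Longrightarrow> a n < \<epsilon> powr s"
      using order_tendstoD(2)[OF a_lim] unfolding eventually_sequentially by blast
    have "\<Psi> w \<le> \<epsilon>" if w: "N < length w" for w
    proof (rule ccontr)
      assume "\<not> \<Psi> w \<le> \<epsilon>"
      then have "\<epsilon> powr s \<le> \<Psi> w powr s" using \<open>0 < \<epsilon>\<close> s by (intro powr_mono2) auto
      moreover obtain n where "length w = Suc n" "N \<le> n" using w by (cases "length w") auto
      ultimately show False using a_ge N by fastforce
    qed
    then show ?thesis by blast
  qed
  have "hausdorff_premeasure s \<delta> (W_set \<Phi> \<Psi>) = 0" if "0 < \<delta>" for \<delta>
  proof -
    obtain N0 where N0: "\<And>w. N0 < length w \<Longrightarrow> \<Psi> w \<le> \<delta> / 2" using small[of "\<delta> / 2"] \<open>0 < \<delta>\<close> by auto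
    have bound: "hausdorff_premeasure s \<delta> (W_set \<Phi> \<Psi>)
        \<le> ennreal (2 powr s * (\<Sum>n. a (n + N)))" if "N0 \<le> N" for N
    proof -
      define V where "V z = (case z of (w, l) \<Rightarrow> if length w < Suc N \<or> length w \<le> l then {}
        else ball (coding \<Phi> (take l w \<frown> (drop l w)\<^sup>\<omega>)) (\<Psi> w))" for z :: "'a list \<times> nat"
      let ?R = "range (to_nat :: 'a list \<times> nat \<Rightarrow> nat)"
      define U where "U i = (if i \<in> ?R then V (from_nat i) else {})" for i
      have V_bd: "bounded (V z) \<and> diameter (V z) \<le> \<delta>" for z
      proof -
        obtain w l where z: "z = (w, l)" by fastforce
        have "2 * \<Psi> w \<le> \<delta>" if "\<not> length w < Suc N" using N0[of w] that \<open>N0 \<le> N\<close> by auto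
        then show ?thesis using \<open>0 < \<delta>\<close> by (auto simp: V_def z)
      qed
      have "W_set \<Phi> \<Psi> \<subseteq> (\<Union>i. U i)"
      proof
        fix x assume "x \<in> W_set \<Phi> \<Psi>"
        then have "x \<in> (\<Union>n\<in>{Suc N..}. \<Union>w\<in>{w. length w = n}. \<Union>l\<in>{0..n - 1}.
            ball (coding \<Phi> (take l w \<frown> (drop l w)\<^sup>\<omega>)) (\<Psi> w))"
          unfolding W_set_def by (rule INT_D) simp
        then obtain n w l where "n \<in> {Suc N..}" "w \<in> {w. length w = n}" "l \<in> {0..n - 1}"
          "x \<in> ball (coding \<Phi> (take l w \<frown> (drop l w)\<^sup>\<omega>)) (\<Psi> w)"
          by (elim UN_E) (rule that)
        then have "x \<in> V (w, l)" by (auto simp: V_def)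
        then have "x \<in> U (to_nat (w, l))" by (simp add: U_def)
        then show "x \<in> (\<Union>i. U i)" by blast
      qed
      moreover have "bounded (U i) \<and> diameter (U i) \<le> \<delta>" for i
        using V_bd \<open>0 < \<delta>\<close> by (auto simp: U_def)
      ultimately have "hausdorff_premeasure s \<delta> (W_set \<Phi> \<Psi>) \<le> (\<Sum>i. hausdorff_gauge s (U i))"
        unfolding hausdorff_premeasure_def by (intro INF_lower) blast
      also have "\<dots> = (\<Sum>i. if i \<in> ?R then hausdorff_gauge s (V (from_nat i)) else 0)"
        by (intro suminf_cong) (auto simp: U_def hausdorff_gauge_def)
      also have "\<dots> = (\<integral>\<^sup>+z. hausdorff_gauge s (V z) \<partial>count_space UNIV)"
        by (rule suminf_enumerate)
      also have "\<dots> \<le> (\<Sum>n. if Suc N \<le> Suc n then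
          \<Sum>w\<in>{w :: 'a list. length w = Suc n}. ennreal (real (Suc n) * (2 powr s * \<Psi> w powr s)) else 0)"
      proof (rule nn_integral_words_le)
        show "hausdorff_gauge s (V (w, l)) = 0" if "length w < Suc N \<or> length w \<le> l" for w l
          using that by (simp add: V_def hausdorff_gauge_def)
        show "hausdorff_gauge s (V (w, l)) \<le> ennreal (2 powr s * \<Psi> w powr s)" for w l
        proof (cases "length w < Suc N \<or> length w \<le> l")
          case True
          then show ?thesis by (simp add: V_def hausdorff_gauge_def)
        next
          case False
          then have "V (w, l) = ball (coding \<Phi> (take l w \<frown> (drop l w)\<^sup>\<omega>)) (\<Psi> w)"
            by (simp only: V_def prod.case if_False)
          then show ?thesis using hausdorff_gauge_ball_le[OF s] by metis
        qed
      qed simp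
      also have "\<dots> = (\<Sum>n. if N \<le> n then ennreal (2 powr s * a n) else 0)"
      proof (intro suminf_cong)
        fix n
        have "(\<Sum>w\<in>{w :: 'a list. length w = Suc n}. ennreal (real (Suc n) * (2 powr s * \<Psi> w powr s)))
            = ennreal (2 powr s * a n)"
          by (subst sum_ennreal) (auto simp: a_def sum_distrib_left mult_ac)
        then show "(if Suc N \<le> Suc n then \<Sum>w\<in>{w :: 'a list. length w = Suc n}.
            ennreal (real (Suc n) * (2 powr s * \<Psi> w powr s)) else 0)
            = (if N \<le> n then ennreal (2 powr s * a n) else 0)" by (simp only: Suc_le_mono)
      qed
      also have "\<dots> = (\<Sum>n. ennreal (2 powr s * a (n + N)))"
      proof -
        let ?f = "\<lambda>n. if N \<le> n then ennreal (2 powr s * a n) else 0"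
        have "(\<Sum>n. ?f n) = (\<Sum>n. ?f (n + N)) + (\<Sum>n<N. ?f n)"
          by (rule suminf_offset) simp
        then show ?thesis by simp
      qed
      also have "\<dots> = ennreal (\<Sum>n. 2 powr s * a (n + N))"
        using a a_nonneg by (intro suminf_ennreal2) (auto simp: summable_iff_shift)
      also have "(\<Sum>n. 2 powr s * a (n + N)) = 2 powr s * (\<Sum>n. a (n + N))"
        using a by (intro suminf_mult) (auto simp: summable_iff_shift)
      finally show ?thesis .
    qed
    have "(\<lambda>N. \<Sum>n. a (n + N)) \<longlonglongrightarrow> 0"
      using suminf_exist_split2[OF a] by simp
    then have "(\<lambda>N. ennreal (2 powr s * (\<Sum>n. a (n + N)))) \<longlonglongrightarrow> ennreal (2 powr s * 0)"
      by (intro tendsto_ennrealI tendsto_mult_left)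
    then have "hausdorff_premeasure s \<delta> (W_set \<Phi> \<Psi>) \<le> ennreal (2 powr s * 0)"
      using bound by (intro LIMSEQ_le_const) auto
    then show ?thesis by simp
  qed
  then show ?thesis
    unfolding hausdorff_measure_def by (simp add: SUP_eq_const bot_ennreal[symmetric] flip: bot_ennreal)
qed

section \<open>Recurrence and approximation by eventually periodic points\<close>

lemma sum_over_length_prod:
  fixes q :: "'a::finite \<Rightarrow> real"
  shows "(\<Sum>w\<in>{w. length w = n}. prod_list (map q w)) = (\<Sum>a\<in>UNIV. q a) ^ n"
proof (induction n)
  case (Suc n)
  have "(\<Sum>w\<in>{w :: 'a list. length w = Suc n}. prod_list (map q w))
      = (\<Sum>(a, w)\<in>UNIV \<times> {w. length w = n}. q a * prod_list (map q w))"
    by (rule sum.reindex_bij_witness[of _ "\<lambda>(a, w). a # w" "\<lambda>w. (hd w, tl w)"])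
      (auto simp: length_Suc_conv)
  also have "\<dots> = (\<Sum>a\<in>UNIV. q a) * (\<Sum>w\<in>{w. length w = n}. prod_list (map q w))"
    by (simp add: sum_product sum.cartesian_product)
  finally show ?case by (simp add: Suc)
qed simp

text \<open>With t the fourth root of \<open>\<rho>\<close>, the term is at most n t^n / t^3, since
  remainders mod 4 are at most 3. This controls the loss from discarding the n with c(n) <= pmax^(n
  div 4).\<close>

lemma summable_mult_power_div:
  fixes \<rho> :: real
  assumes "0 < \<rho>" "\<rho> < 1"
  shows "summable (\<lambda>n. real n * \<rho> ^ (n div 4))"
proof -
  define t where "t = \<rho> powr (1 / 4)"
  have t: "0 < t" "t < 1" using assms powr_less_mono'[of \<rho> 0 "1 / 4"] by (auto simp: t_def)
  have t4: "t ^ 4 = \<rho>" using assms by (simp add: t_def powr_powr flip: powr_realpow)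
  have "\<rho> ^ (n div 4) \<le> t ^ n / t ^ 3" for n
  proof -
    have "t ^ n * 1 = t ^ (4 * (n div 4)) * t ^ (n mod 4)"
      by (simp flip: power_add)
    moreover have "t ^ 3 \<le> t ^ (n mod 4)" using t by (intro power_decreasing) auto
    ultimately have "\<rho> ^ (n div 4) * t ^ 3 \<le> t ^ n"
      using t by (simp add: power_mult t4 mult_left_mono assms less_imp_le)
    then show ?thesis using t by (simp add: field_simps)
  qed
  then have "norm (real n * \<rho> ^ (n div 4)) \<le> real (Suc n) * t ^ n / t ^ 3" for n
    using assms t mult_mono[of "real n" "real (Suc n)" "\<rho> ^ (n div 4)" "t ^ n / t ^ 3"] by simp
  moreover have "summable (\<lambda>n. real (Suc n) * t ^ n / t ^ 3)"
    using geometric_deriv_sums[of t] t by (intro summable_divide) (auto simp: sums_iff)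
  ultimately show ?thesis by (rule summable_comparison_test'[of _ 0, rotated])
qed

lemma conc_iter_eq_letter:
  fixes x :: "nat \<Rightarrow> 'a"
  assumes "l < n"
  defines "y \<equiv> take l (map x [0..<n]) \<frown> (drop l (map x [0..<n]))\<^sup>\<omega>"
  shows "i < n \<Longrightarrow> y i = x i" and "y (n + j) = y (l + j)"
proof -
  have y: "y i = (if i < l then x i else x (l + (i - l) mod (n - l)))" for i
  proof (cases "i < l")
    case False
    have "(i - l) mod (n - l) < n - l" using \<open>l < n\<close> by simp
    then have "l + (i - l) mod (n - l) < n" by linarith
    with False \<open>l < n\<close> show ?thesis by (simp add: y_def conc_def)
  qed (use \<open>l < n\<close> in \<open>simp add: y_def conc_def\<close>)
  show "y i = x i" if "i < n" using that by (simp add: y)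
  have "(n + j - l) mod (n - l) = j mod (n - l)"
  proof -
    have "n + j - l = (n - l) + j" using \<open>l < n\<close> by simp
    then show ?thesis by (simp only: mod_add_self1)
  qed
  then show "y (n + j) = y (l + j)" using \<open>l < n\<close> by (simp add: y)
qed

context ifs
begin

lemma powr_word_ratio: "word_ratio w powr similarity_dim \<Phi> = prod_list (map (weight \<Phi>) w)"
  by (induction w) (auto simp: word_ratio_def weight_def powr_mult)

lemma powr_prod_ratio:
  "(\<Prod>i<k. weight \<Phi> (x i)) = (\<Prod>i<k. r (x i)) powr similarity_dim \<Phi>"
  by (simp add: weight_def prod_powr_distrib less_imp_le[OF r_pos])

lemma word_ratio_map_upt: "word_ratio (map x [0..<n]) = (\<Prod>i<n. r (x i))"
  by (induction n) (auto simp: word_ratio_def mult.commute)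

text \<open>The weights p_w = r_w^s of the words of a given length sum to 1, so the inner sum
  collapses to a single term.\<close>

lemma word_series_cylinders:
  assumes g: "\<And>n. 1 \<le> n \<Longrightarrow> 0 \<le> g n"
  defines "s \<equiv> similarity_dim \<Phi>"
  shows "word_series s (\<lambda>w. diameter (cylinder_set \<Phi> w) * g (length w))
    = (\<Sum>n. ennreal (diam powr s * (real (Suc n) * g (Suc n) powr s)))"
  unfolding word_series_def
proof (intro suminf_cong)
  fix n
  have "(\<Sum>w\<in>{w :: 'a list. length w = Suc n}.
        real (Suc n) * (diameter (cylinder_set \<Phi> w) * g (length w)) powr s)
      = (\<Sum>w\<in>{w :: 'a list. length w = Suc n}.
        diam powr s * (real (Suc n) * g (Suc n) powr s) * prod_list (map (weight \<Phi>) w))"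
    by (intro sum.cong refl) (auto simp: diameter_cylinder powr_mult g word_ratio_pos less_imp_le
        diameter_ge_0 bounded_self_similar_set s_def simp flip: powr_word_ratio)
  also have "\<dots> = diam powr s * (real (Suc n) * g (Suc n) powr s)"
    by (simp only: sum_distrib_left[symmetric] sum_over_length_prod sum_weight power_one mult_1_right)
  finally show "(\<Sum>w\<in>{w :: 'a list. length w = Suc n}.
      ennreal (real (Suc n) * (diameter (cylinder_set \<Phi> w) * g (length w)) powr s))
      = ennreal (diam powr s * (real (Suc n) * g (Suc n) powr s))"
    by (subst sum_ennreal) auto
qed

text \<open>In both sequences place n + j repeats place l + j for all j below the cut length
  \<open>k\<close>, so they share a prefix of length n + k. Its ratio is that of the word times that
  of the cut word, and the latter is below \<open>g\<close> because its power is below c <= g^s.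
  Positive \<open>diam\<close> keeps the inequality strict, as an open ball requires.\<close>

lemma coding_in_ball:
  assumes B: "bernoulli_scheme (weight \<Phi>)" and s: "0 < similarity_dim \<Phi>" and diam: "0 < diam"
    and "l < n" and g: "0 \<le> g" and c: "c \<le> g powr similarity_dim \<Phi>"
    and K: "bernoulli_scheme.pmax (weight \<Phi>) ^ K < c"
    and x: "x \<in> bernoulli_scheme.recurrence (weight \<Phi>) c K n l"
  shows "coding \<Phi> x \<in> ball (coding \<Phi> (take l (map x [0..<n]) \<frown> (drop l (map x [0..<n]))\<^sup>\<omega>))
    (diameter (cylinder_set \<Phi> (map x [0..<n])) * g)"
proof -
  interpret B: bernoulli_scheme "weight \<Phi>" by (rule B)
  let ?y = "take l (map x [0..<n]) \<frown> (drop l (map x [0..<n]))\<^sup>\<omega>"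
  obtain k where k: "k \<le> K" "\<And>j. B.uncut c l j x \<longleftrightarrow> j < k"
    "(\<Prod>i<k. weight \<Phi> (x (l + i))) < c" using B.cut_length_exists[OF K] by metis
  have rec: "x (n + j) = x (l + j)" if "j < k" for j
    by (rule B.recurrenceD[OF x k(1,2) that])
  \<comment> \<open>The induction is strong because l + j may again be n or larger, namely when the
    cut word is longer than the period n - l.\<close>
  have agree: "x i = ?y i" if "i < n + k" for i
    using that
  proof (induction i rule: less_induct)
    case (less i)
    show ?case
    proof (cases "i < n")
      case True
      show ?thesis by (rule conc_iter_eq_letter(1)[OF \<open>l < n\<close> True, symmetric])
    next
      case False
      then obtain j where i: "i = n + j" by (metis le_Suc_ex not_less)
      then have "x i = x (l + j)" using rec less.prems by simp
      also have "\<dots> = ?y (l + j)" using less i \<open>l < n\<close> by simp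
      also have "\<dots> = ?y i" unfolding i by (rule conc_iter_eq_letter(2)[OF \<open>l < n\<close>, symmetric])
      finally show ?thesis .
    qed
  qed
  have "(\<Prod>i<k. r (x (l + i))) powr similarity_dim \<Phi> < g powr similarity_dim \<Phi>"
    using k(3) c powr_prod_ratio[of "\<lambda>i. x (l + i)" k] by simp
  then have u: "(\<Prod>i<k. r (x (l + i))) < g"
    using g s powr_mono2[of "similarity_dim \<Phi>" g "\<Prod>i<k. r (x (l + i))"] by linarith
  have "word_ratio (map x [0..<n + k]) = word_ratio (map x [0..<n]) * (\<Prod>i<k. r (x (n + i)))"
    by (simp add: map_upt_add word_ratio_append word_ratio_map_upt del: upt_Suc)
  also have "(\<Prod>i<k. r (x (n + i))) = (\<Prod>i<k. r (x (l + i)))"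
    by (intro prod.cong refl) (simp add: rec)
  finally have "dist (coding \<Phi> x) (coding \<Phi> ?y)
      \<le> word_ratio (map x [0..<n]) * (\<Prod>i<k. r (x (l + i))) * diam"
    using dist_coding_le[of "n + k" x ?y] agree by simp
  also have "\<dots> < word_ratio (map x [0..<n]) * g * diam"
    using u diam word_ratio_pos by (intro mult_strict_right_mono mult_strict_left_mono) auto
  finally show ?thesis by (simp add: diameter_cylinder dist_commute mult_ac)
qed

lemma coding_measurable:
  assumes "bernoulli_scheme (weight \<Phi>)"
  shows "coding \<Phi> \<in> borel_measurable (bernoulli_measure (weight \<Phi>))"
proof -
  interpret B: bernoulli_scheme "weight \<Phi>" by (rule assms)
  have "(\<lambda>x. word_map \<Phi> (map x [0..<n]) 0) \<in> borel_measurable (bernoulli_measure (weight \<Phi>))" for n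
  proof (rule B.determined_on_measurable[of "{..<n}"])
    show "determined_on {..<n} (\<lambda>x. word_map \<Phi> (map x [0..<n]) 0)"
    proof (rule determined_onI)
      fix x y :: "nat \<Rightarrow> 'a" assume "\<And>i. i \<in> {..<n} \<Longrightarrow> x i = y i"
      then have "map x [0..<n] = map y [0..<n]" by simp
      then show "word_map \<Phi> (map x [0..<n]) 0 = word_map \<Phi> (map y [0..<n]) 0" by (rule arg_cong)
    qed
  qed simp
  then have "(\<lambda>x. lim (\<lambda>n. word_map \<Phi> (map x [0..<n]) 0))
      \<in> borel_measurable (bernoulli_measure (weight \<Phi>))"
    by (rule borel_measurable_lim_metric)
  then show ?thesis by (simp add: coding_def[abs_def])
qed

lemma sets_W_set: "W_set \<Phi> \<Psi> \<in> sets borel"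
proof -
  have "(\<Union>w\<in>{w. length w = n}. \<Union>l\<in>{0..n - 1}.
      ball (coding \<Phi> (take l w \<frown> (drop l w)\<^sup>\<omega>)) (\<Psi> w)) \<in> sets borel" for n
    by (intro borel_open open_UN ballI open_ball)
  then show ?thesis
    unfolding W_set_def by (intro sets.countable_INT'' sets.countable_UN) auto
qed

text \<open>A vanishing diameter would annihilate the series, so divergence yields a positive
  diameter, hence two distinct letters, a positive dimension and weights strictly between 0 and
  1.\<close>

theorem emeasure_W_set_eq_1:
  fixes g :: "nat \<Rightarrow> real"
  assumes g: "\<And>n. 1 \<le> n \<Longrightarrow> 0 \<le> g n"
    and \<Psi>: "\<And>w. w \<noteq> [] \<Longrightarrow> \<Psi> w = diameter (cylinder_set \<Phi> w) * g (length w)"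
    and div: "word_series (similarity_dim \<Phi>) (\<lambda>w. diameter (cylinder_set \<Phi> w) * g (length w)) = \<infinity>"
  shows "emeasure (self_similar_measure \<Phi>) (W_set \<Phi> \<Psi>) = 1"
proof -
  define s where "s = similarity_dim \<Phi>"
  have div': "(\<Sum>n. ennreal (diam powr s * (real (Suc n) * g (Suc n) powr s))) = \<infinity>"
    using div word_series_cylinders[of g] g unfolding s_def by metis
  have diam: "0 < diam"
  proof (rule ccontr)
    assume "\<not> 0 < diam"
    then have "diam = 0" using diameter_ge_0[OF bounded_self_similar_set] by linarith
    with div' show False by simp
  qed
  then obtain a b :: 'a where "a \<noteq> b" using diam_single_letter by (metis less_irrefl)
  then have s: "0 < s" and B: "bernoulli_scheme (weight \<Phi>)"
    by (auto simp: s_def similarity_dim_pos bernoulli_scheme_weight)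
  interpret B: bernoulli_scheme "weight \<Phi>" by (rule B)
  \<comment> \<open>Capping at 1, the weight of the empty word, keeps the cut word non-empty and its
    weight comparable to \<open>c n\<close>.\<close>
  define c where "c n = min 1 (g n powr s)" for n
  have c: "0 \<le> c n" "c n \<le> 1" for n by (auto simp: c_def)
  let ?h = "\<lambda>n. if B.pmax ^ (n div 4) < c n then real n * c n else 0"
  \<comment> \<open>Restoring the discarded n costs a convergent series, so n c(n) would be
    summable. Its terms would eventually fall below 1, where the cap is inactive, and the original
    series would converge.\<close>
  have "\<not> summable ?h"
  proof
    assume "summable ?h"
    then have "summable (\<lambda>n. ?h n + real n * B.pmax ^ (n div 4))"
      using B.pmax_pos B.pmax_less_1 by (intro summable_add summable_mult_power_div)
    then have nc: "summable (\<lambda>n. real n * c n)"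
      by (rule summable_comparison_test'[of _ 0])
        (use c B.pmax_pos in \<open>auto intro: mult_left_mono\<close>)
    have "\<forall>\<^sub>F n in sequentially. real n * c n < 1"
      using summable_LIMSEQ_zero[OF nc] by (rule order_tendstoD) simp
    then have "\<forall>\<^sub>F n in sequentially. real n * c n = real n * g n powr s"
      using eventually_ge_at_top[of 1]
    proof eventually_elim
      case (elim n)
      have "1 * c n \<le> real n * c n" using elim c by (intro mult_right_mono) auto
      then have "c n < 1" using elim by simp
      then show ?case by (simp add: c_def min_def split: if_splits)
    qed
    from summable_cong[OF this] nc have "summable (\<lambda>n. real n * g n powr s)" by blast
    then have "summable (\<lambda>n. real (Suc n) * g (Suc n) powr s)" by (subst summable_Suc_iff)
    then have "summable (\<lambda>n. diam powr s * (real (Suc n) * g (Suc n) powr s))"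
      by (rule summable_mult)
    then have "(\<Sum>n. ennreal (diam powr s * (real (Suc n) * g (Suc n) powr s))) \<noteq> top"
      by (rule ennreal_suminf_neq_top) auto
    with div' show False by simp
  qed
  then have prob: "B.prob (\<Inter>N. \<Union>d\<in>B.return_times c N. B.returns c d) = 1" (is "B.prob ?T = 1")
    by (intro B.prob_limsup_returns c)
  have "?T \<subseteq> coding \<Phi> -` W_set \<Phi> \<Psi>"
  proof
    fix x assume x: "x \<in> ?T"
    have "\<exists>n\<ge>N. \<exists>w. length w = n \<and> (\<exists>l\<in>{0..n - 1}.
        coding \<Phi> x \<in> ball (coding \<Phi> (take l w \<frown> (drop l w)\<^sup>\<omega>)) (\<Psi> w))" for N
    proof -
      obtain d where d: "d \<in> B.return_times c N" "x \<in> B.returns c d" using x by blast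
      define n l where "n = fst d" and "l = snd d"
      have n: "N \<le> n" "l < n" "0 < n" "B.pmax ^ (n div 4) < c n"
        using B.return_times_pos[OF d(1) c(2)] d(1) by (auto simp: n_def l_def B.return_times_def)
      have "coding \<Phi> x \<in> ball (coding \<Phi> (take l (map x [0..<n]) \<frown> (drop l (map x [0..<n]))\<^sup>\<omega>))
          (diameter (cylinder_set \<Phi> (map x [0..<n])) * g n)"
        using n g d(2) diam s
        by (intro coding_in_ball[of _ _ _ "c n" "n div 4"] B)
          (auto simp: c_def s_def n_def l_def B.returns_def)
      moreover have "\<Psi> (map x [0..<n]) = diameter (cylinder_set \<Phi> (map x [0..<n])) * g n"
        using \<Psi>[of "map x [0..<n]"] n by simp
      ultimately show ?thesis
        using n by (intro exI[of _ n] conjI exI[of _ "map x [0..<n]"] bexI[of _ l]) auto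
    qed
    then show "x \<in> coding \<Phi> -` W_set \<Phi> \<Psi>" unfolding W_set_def by fastforce
  qed
  moreover have meas: "coding \<Phi> -` W_set \<Phi> \<Psi> \<in> B.events"
    using measurable_sets[OF coding_measurable[OF B] sets_W_set] by simp
  ultimately have "1 \<le> B.prob (coding \<Phi> -` W_set \<Phi> \<Psi>)"
    using B.finite_measure_mono prob by metis
  then have "B.prob (coding \<Phi> -` W_set \<Phi> \<Psi>) = 1" using B.prob_le_1 by (rule antisym[rotated])
  then show ?thesis
    unfolding self_similar_measure_def
    by (subst emeasure_distr[OF coding_measurable[OF B] sets_W_set])
      (simp add: B.emeasure_eq_measure)
qed

end

theorem theorem1p1:
  fixes \<Phi> :: "'a::finite \<Rightarrow> real ^ 'd \<Rightarrow> real ^ 'd"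
    and \<Psi> :: "'a list \<Rightarrow> real"
  assumes "IFS \<Phi>"
    and "\<And>w. w \<noteq> [] \<Longrightarrow> 0 \<le> \<Psi> w"
  shows
    "(\<forall>s\<ge>0. word_series s \<Psi> < \<infinity> \<longrightarrow> hausdorff_measure s (W_set \<Phi> \<Psi>) = 0)
     \<and>
     (\<forall>g :: nat \<Rightarrow> real.
        entropy_of (weight \<Phi>) < - 2 * ln (\<Sum>a\<in>UNIV. (weight \<Phi> a)\<^sup>2)
        \<and> (\<forall>n\<ge>1. 0 \<le> g n)
        \<and> (\<forall>m n. 1 \<le> m \<and> m \<le> n \<longrightarrow> g n \<le> g m)
        \<and> (\<forall>w. w \<noteq> [] \<longrightarrow> \<Psi> w = diameter (cylinder_set \<Phi> w) * g (length w))
        \<and> word_series (similarity_dim \<Phi>)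
            (\<lambda>w. diameter (cylinder_set \<Phi> w) * g (length w)) = \<infinity>
        \<longrightarrow> emeasure (self_similar_measure \<Phi>) (W_set \<Phi> \<Psi>) = 1)
     \<and>
     (\<forall>g :: nat \<Rightarrow> real.
        equicontractive \<Phi>
        \<and> (\<forall>n\<ge>1. 0 \<le> g n)
        \<and> (\<forall>w. w \<noteq> [] \<longrightarrow> \<Psi> w = diameter (cylinder_set \<Phi> w) * g (length w))
        \<and> word_series (similarity_dim \<Phi>)
            (\<lambda>w. diameter (cylinder_set \<Phi> w) * g (length w)) = \<infinity>
        \<longrightarrow> emeasure (self_similar_measure \<Phi>) (W_set \<Phi> \<Psi>) = 1)"
proof -
  interpret ifs \<Phi> by unfold_locales (rule assms(1))
  show ?thesis
    using hausdorff_measure_W_set_eq_0[of _ \<Psi> \<Phi>] emeasure_W_set_eq_1[of _ \<Psi>] by blast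
qed

end
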